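(* Let $n\ge1$ and let $f\in\boldsymbol{B_2}$ be such that $h(x):=\partial_x^{n-1}f(x,y)|_{x=y}$ satisfies $h(x)\neq0$ for all $x\in[a,b]$ and (if $n\ge2$) $\partial_x^if(x,y)|_{x=y}=0$ for $i=0,1,\dots,n-2$. Let $\phi\in D^n[a,b]$. Put $k(x,y)=-\partial_x^nf(x,y)/h(x)$, let $H=\sum_{i\ge1}k_i$ be the resolvent kernel of $k$, and, working in the operator algebra $\widehat I_M$, write $$\sum_{i=1}^n\big(k(x,y)\theta(x-y)\big)^{*i}*\tfrac1{h(x)}\partial_x^n=\mathcal O_1(x,\partial_x)+C(x,y)\theta(x-y),$$ $$\big(k(x,y)\theta(x-y)\big)^{*n}*\tfrac1{h(x)}\partial_x^n=S(x)+D(x,y)\theta(x-y),$$ where $\mathcal O_1(x,\partial_x)$ is a differential operator with coefficients in $\boldsymbol{B_1}$, $S\in\boldsymbol{B_1}$ and $C,D\in\boldsymbol{B_2}$. Set $$\mathcal O(x,\partial_x)=\frac1{h(x)}\partial_x^n+\mathcal O_1(x,\partial_x),\qquad R(x,y)=C(x,y)+S(y)H(x,y)+\int_y^xH(x,z)D(z,y)\,dz .$$ Then the solution $y\in C[a,b]$ of the Volterra integral equation of the first kind $$\int_a^xf(x,z)\,y(z)\,dz=\phi(x),\qquad x\in[a,b],$$ is given by $$y(x)=\mathcal O(x,\partial_x)\phi(x)+\int_a^xR(x,z)\,\phi(z)\,dz .$$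
   Context: Fix real numbers $a<b$. $\boldsymbol{B_1}$ is the algebra of smooth functions $[a,b]\to\mathbb C$. $\Delta=\{(x,y): a\le y\le x\le b\}$, and $\boldsymbol{B_2}$ is the algebra of smooth functions $\Delta\to\mathbb C$ (all partial derivatives of all orders exist and are continuous on $\Delta$). $D^n[a,b]$ is the space of $n$ times continuously differentiable functions $\phi:[a,b]\to\mathbb C$ with $\partial_x^k\phi(a)=0$ for $k=0,\dots,n-1$. $M[a,b]$ is the space of smooth functions $[a,b]\to\mathbb C$ all of whose derivatives (including order $0$) vanish at $a$. $\widehat I_M$ is the subalgebra of $\mathrm{End}_{\mathbb C}(M[a,b])$ generated by the operators $\phi\mapsto P\phi$ ($P\in\boldsymbol{B_1}$), $\partial_x$, and $f(x,y)\theta(x-y):\phi\mapsto\int_a^xf(x,z)\phi(z)\,dz$ ($f\in\boldsymbol{B_2}$); $*$ denotes composition and ${}^{*i}$ the $i$-th power under composition. Every element of $\widehat I_M$ is uniquely the sum of a differential operator $\sum_{i=0}^mP_i(x)\partial_x^i$ with $P_i\in\boldsymbol{B_1}$ and an operator $f(x,y)\theta(x-y)$ with $f\in\boldsymbol{B_2}$. The resolvent kernel of $k\in\boldsymbol{B_2}$ is $H=\sum_{i\ge1}k_i\in\boldsymbol{B_2}$ (uniformly convergent on $\Delta$), where $k_1=k$ and $k_i(x,y)=\int_y^xk(x,z)k_{i-1}(z,y)\,dz$ for $i\ge2$. "The solution" means that the equation has exactly one solution in $C[a,b]$. *)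

theory Defs
  imports "HOL-Analysis.Analysis"
begin

text \<open>
  Functions on \<open>[a,b]\<close> and on the triangle are total functions of which only the values on
  \<open>{a..b}\<close>, respectively on \<open>triangle a b\<close>, matter. Derivatives at boundary points are one-sided.
\<close>

definition deriv_op :: "real \<Rightarrow> real \<Rightarrow> (real \<Rightarrow> complex) \<Rightarrow> real \<Rightarrow> complex" where
  "deriv_op a b \<phi> x = vector_derivative \<phi> (at x within {a..b})"

definition C_diff :: "real \<Rightarrow> real \<Rightarrow> nat \<Rightarrow> (real \<Rightarrow> complex) set" where
  "C_diff a b n = {\<phi>.
     (\<forall>k<n. \<forall>x\<in>{a..b}. (deriv_op a b ^^ k) \<phi> differentiable (at x within {a..b})) \<and>
     (\<forall>k\<le>n. continuous_on {a..b} ((deriv_op a b ^^ k) \<phi>))}"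

definition B1 :: "real \<Rightarrow> real \<Rightarrow> (real \<Rightarrow> complex) set" where
  "B1 a b = (\<Inter>n. C_diff a b n)"

definition D_space :: "nat \<Rightarrow> real \<Rightarrow> real \<Rightarrow> (real \<Rightarrow> complex) set" where
  "D_space n a b = {\<phi> \<in> C_diff a b n. \<forall>k<n. (deriv_op a b ^^ k) \<phi> a = 0}"

definition M_space :: "real \<Rightarrow> real \<Rightarrow> (real \<Rightarrow> complex) set" where
  "M_space a b = {\<phi> \<in> B1 a b. \<forall>k. (deriv_op a b ^^ k) \<phi> a = 0}"

definition triangle :: "real \<Rightarrow> real \<Rightarrow> (real \<times> real) set" where
  "triangle a b = {(x, y). a \<le> y \<and> y \<le> x \<and> x \<le> b}"

text \<open>
  Partial derivatives on the triangle are taken along its horizontal and vertical sections. The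
  section in direction \<open>x\<close> through the corner \<open>(b,b)\<close>, and the one in direction \<open>y\<close> through the
  corner \<open>(a,a)\<close>, is a single point; there the partial derivative is the limit of its values
  on the rest of the triangle.
\<close>

definition pdx :: "real \<Rightarrow> real \<Rightarrow> (real \<Rightarrow> real \<Rightarrow> complex) \<Rightarrow> real \<Rightarrow> real \<Rightarrow> complex" where
  "pdx a b g x y =
     (if x = b \<and> y = b
      then Lim (at (b, b) within triangle a b)
             (\<lambda>(u, v). vector_derivative (\<lambda>t. g t v) (at u within {v..b}))
      else vector_derivative (\<lambda>t. g t y) (at x within {y..b}))"

definition pdy :: "real \<Rightarrow> real \<Rightarrow> (real \<Rightarrow> real \<Rightarrow> complex) \<Rightarrow> real \<Rightarrow> real \<Rightarrow> complex" where
  "pdy a b g x y =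
     (if x = a \<and> y = a
      then Lim (at (a, a) within triangle a b)
             (\<lambda>(u, v). vector_derivative (\<lambda>t. g u t) (at v within {a..u}))
      else vector_derivative (\<lambda>t. g x t) (at y within {a..x}))"

inductive_set partials :: "real \<Rightarrow> real \<Rightarrow> (real \<Rightarrow> real \<Rightarrow> complex) \<Rightarrow> (real \<Rightarrow> real \<Rightarrow> complex) set"
  for a b :: real and f :: "real \<Rightarrow> real \<Rightarrow> complex" where
  self: "f \<in> partials a b f"
| dx: "g \<in> partials a b f \<Longrightarrow> pdx a b g \<in> partials a b f"
| dy: "g \<in> partials a b f \<Longrightarrow> pdy a b g \<in> partials a b f"

text \<open>
  Continuity of \<open>pdx a b g\<close> and \<open>pdy a b g\<close> forces the limits at the two corners to exist.
\<close>

definition B2 :: "real \<Rightarrow> real \<Rightarrow> (real \<Rightarrow> real \<Rightarrow> complex) set" where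
  "B2 a b = {f. \<forall>g \<in> partials a b f.
     continuous_on (triangle a b) (\<lambda>(x, y). g x y) \<and>
     (\<forall>(x, y) \<in> triangle a b.
        (y < b \<longrightarrow> (\<lambda>t. g t y) differentiable (at x within {y..b})) \<and>
        (a < x \<longrightarrow> (\<lambda>t. g x t) differentiable (at y within {a..x})))}"

definition mult_op :: "(real \<Rightarrow> complex) \<Rightarrow> (real \<Rightarrow> complex) \<Rightarrow> real \<Rightarrow> complex" where
  "mult_op P \<phi> x = P x * \<phi> x"

text \<open>The operator \<open>f(x,y)\<theta>(x-y)\<close>.\<close>

definition volt_op :: "real \<Rightarrow> (real \<Rightarrow> real \<Rightarrow> complex) \<Rightarrow> (real \<Rightarrow> complex) \<Rightarrow> real \<Rightarrow> complex" where
  "volt_op a f \<phi> x = integral {a..x} (\<lambda>z. f x z * \<phi> z)"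

definition diff_op :: "real \<Rightarrow> real \<Rightarrow> nat \<Rightarrow> (nat \<Rightarrow> real \<Rightarrow> complex) \<Rightarrow>
    (real \<Rightarrow> complex) \<Rightarrow> real \<Rightarrow> complex" where
  "diff_op a b m P \<phi> x = (\<Sum>i\<le>m. P i x * (deriv_op a b ^^ i) \<phi> x)"

text \<open>
  Representatives of the elements of the subalgebra of the endomorphisms of \<open>M[a,b]\<close>;
  \<open>IM_eq\<close> is equality in that algebra, i.e. equality of the induced maps on \<open>M[a,b]\<close>.
  Scalars and the identity are obtained from \<open>mult_op\<close> of constant functions.
\<close>

inductive_set IM :: "real \<Rightarrow> real \<Rightarrow> ((real \<Rightarrow> complex) \<Rightarrow> real \<Rightarrow> complex) set"
  for a b :: real where
  mult: "P \<in> B1 a b \<Longrightarrow> mult_op P \<in> IM a b"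
| deriv: "deriv_op a b \<in> IM a b"
| volt: "f \<in> B2 a b \<Longrightarrow> volt_op a f \<in> IM a b"
| add: "A \<in> IM a b \<Longrightarrow> B \<in> IM a b \<Longrightarrow> (\<lambda>\<phi> x. A \<phi> x + B \<phi> x) \<in> IM a b"
| comp: "A \<in> IM a b \<Longrightarrow> B \<in> IM a b \<Longrightarrow> A \<circ> B \<in> IM a b"

definition IM_eq :: "real \<Rightarrow> real \<Rightarrow> ((real \<Rightarrow> complex) \<Rightarrow> real \<Rightarrow> complex) \<Rightarrow>
    ((real \<Rightarrow> complex) \<Rightarrow> real \<Rightarrow> complex) \<Rightarrow> bool" where
  "IM_eq a b A B \<longleftrightarrow> A \<in> IM a b \<and> B \<in> IM a b \<and>
     (\<forall>\<phi> \<in> M_space a b. \<forall>x \<in> {a..b}. A \<phi> x = B \<phi> x)"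

text \<open>\<open>iter_kernel k i\<close> is the iterated kernel \<open>k\<^sub>i\<^sub>+\<^sub>1\<close>, so the resolvent sum starts at \<open>k\<^sub>1 = k\<close>.\<close>

primrec iter_kernel :: "(real \<Rightarrow> real \<Rightarrow> complex) \<Rightarrow> nat \<Rightarrow> real \<Rightarrow> real \<Rightarrow> complex" where
  "iter_kernel k 0 = k"
| "iter_kernel k (Suc i) = (\<lambda>x y. integral {y..x} (\<lambda>z. k x z * iter_kernel k i z y))"

definition resolvent :: "(real \<Rightarrow> real \<Rightarrow> complex) \<Rightarrow> real \<Rightarrow> real \<Rightarrow> complex" where
  "resolvent k x y = (\<Sum>i. iter_kernel k i x y)"

definition volterra_solution :: "real \<Rightarrow> real \<Rightarrow> (real \<Rightarrow> real \<Rightarrow> complex) \<Rightarrow>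
    (real \<Rightarrow> complex) \<Rightarrow> (real \<Rightarrow> complex) \<Rightarrow> bool" where
  "volterra_solution a b f \<phi> u \<longleftrightarrow> continuous_on {a..b} u \<and>
     (\<forall>x \<in> {a..b}. integral {a..x} (\<lambda>z. f x z * u z) = \<phi> x)"

end

theory Submission
  imports Defs
begin

text \<open>
  Write \<open>V\<^sub>g\<close> for the operator \<open>volt_op a g\<close> and put \<open>g = (1 / h) \<partial>\<^sup>n \<phi>\<close>. Differentiating
  \<open>V\<^sub>f y = \<phi>\<close> once gives \<open>f(x,x) y(x) + \<integral> \<partial>\<^sub>x f(x,z) y(z) dz = \<phi>'(x)\<close>. Because \<open>f\<close> and its first
  \<open>n - 2\<close> derivatives in \<open>x\<close> vanish on the diagonal, the boundary term appears only at the \<open>n\<close>-th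
  differentiation, and division by \<open>h\<close> turns the equation into the equation \<open>y = g + V\<^sub>k y\<close> of the
  second kind. No information is lost on the way, since both sides of every intermediate equation
  vanish at \<open>a\<close> (\<open>first_kind_iff\<close>). The equation of the second kind has at most one
  continuous solution (\<open>volt_op_fixpoint_zero\<close>), and for the resolvent kernel \<open>H\<close> the identity
  \<open>V\<^sub>H = V\<^sub>k + V\<^sub>k V\<^sub>H\<close> shows that \<open>g + \<Sum>\<^sub>1\<^sub>\<le>\<^sub>i\<^sub>\<le>\<^sub>n V\<^sub>k\<^sup>i g + V\<^sub>H V\<^sub>k\<^sup>n g\<close> is a solution
  (\<open>second_kind_solution\<close>). The first sum is \<open>A1 \<phi>\<close>, and \<open>V\<^sub>k\<^sup>n g\<close> is \<open>A2 \<phi>\<close>, so that the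
  decompositions of \<open>A1\<close> and \<open>A2\<close> turn this solution into the asserted formula.

  That these decompositions exist is integration by parts: for functions that vanish at \<open>a\<close>,
  \<open>V\<^sub>E \<partial>\<close> is again the sum of a multiplication operator and a Volterra operator. Hence the set of
  such sums is mapped into itself by \<open>B \<mapsto> V\<^sub>k B \<partial>\<close>, and \<open>n\<close> such steps starting at the
  multiplication by \<open>1 / h\<close> lead to \<open>A2\<close> (\<open>volt_op_funpow_deriv_funpow\<close>). The computation needs
  only \<open>n\<close> derivatives and thus is valid on \<open>D_space n a b\<close>, not just on \<open>M_space a b\<close>.

  An arbitrary decomposition, however, is known to be valid on \<open>M_space a b\<close> only, and its differential
  operator may formally have an order above \<open>n\<close>, while \<open>\<phi>\<close> has \<open>n\<close> derivatives. Therefore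
  uniqueness of the coefficients is needed. It is tested with the functions
  \<open>(z - x)\<^sup>j q(z) exp(- 1 / (z - a))\<close>, which belong to \<open>M_space a b\<close> and have a prescribed jet at \<open>x\<close>
  (\<open>IM_decomposition_zero\<close>).

  The smoothness of all kernels rests on the composition \<open>kcomp\<close> of kernels, of which \<open>volt_op\<close> is a
  special case. Its associativity is Fubini's theorem on a triangle, and Leibniz's rule for
  integrals with a variable limit is derived from the associativity.
\<close>

section \<open>Kernels that are continuous on the triangle\<close>

text \<open>Closure properties of \<open>B2\<close> are proved by induction on the order \<open>n\<close> of differentiability: a
  derivative of a product or of a composition is built from the two factors and their derivatives,
  all of which lie in the class of order \<open>n - 1\<close>. The intersection of these classes is \<open>B2\<close>.\<close>

primrec C_tri :: "real \<Rightarrow> real \<Rightarrow> nat \<Rightarrow> (real \<Rightarrow> real \<Rightarrow> complex) set" where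
  "C_tri a b 0 = {f. continuous_on (triangle a b) (\<lambda>(x, y). f x y)}"
| "C_tri a b (Suc n) = {f. continuous_on (triangle a b) (\<lambda>(x, y). f x y) \<and>
     (\<forall>(x, y) \<in> triangle a b.
        (y < b \<longrightarrow> (\<lambda>t. f t y) differentiable (at x within {y..b})) \<and>
        (a < x \<longrightarrow> (\<lambda>t. f x t) differentiable (at y within {a..x}))) \<and>
     pdx a b f \<in> C_tri a b n \<and> pdy a b f \<in> C_tri a b n}"

text \<open>Volterra's composition of kernels. At \<open>y = a\<close>, and with a second factor that does not depend on its
  second variable, this is \<open>volt_op\<close>; facts about operators are therefore read off from facts about kernels.\<close>

definition kcomp :: "(real \<Rightarrow> real \<Rightarrow> complex) \<Rightarrow> (real \<Rightarrow> real \<Rightarrow> complex) \<Rightarrow>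
    real \<Rightarrow> real \<Rightarrow> complex" where
  "kcomp f g x y = integral {y..x} (\<lambda>z. f x z * g z y)"

lemma mem_triangle [simp]: "(x, y) \<in> triangle a b \<longleftrightarrow> a \<le> y \<and> y \<le> x \<and> x \<le> b"
  by (simp add: triangle_def)

lemma C_tri_cont: "f \<in> C_tri a b n \<Longrightarrow> f \<in> C_tri a b 0"
  by (cases n) auto

declare C_tri.simps(2) [simp del]

lemma C_tri_0_compose:
  assumes "f \<in> C_tri a b 0" "continuous_on S u" "continuous_on S v"
    and "\<And>s. s \<in> S \<Longrightarrow> a \<le> v s \<and> v s \<le> u s \<and> u s \<le> b"
  shows "continuous_on S (\<lambda>s. f (u s) (v s))"
proof -
  have "continuous_on S ((\<lambda>(x, y). f x y) \<circ> (\<lambda>s. (u s, v s)))"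
    by (rule continuous_on_compose)
       (use assms in \<open>auto intro!: continuous_on_Pair intro: continuous_on_subset\<close>)
  then show ?thesis by (simp add: o_def)
qed

lemma C_tri_0_fst: "continuous_on {a..b} u \<Longrightarrow> (\<lambda>x y. u x) \<in> C_tri a b 0"
  by (auto simp: case_prod_beta intro!: continuous_on_compose2[of "{a..b}" u] continuous_intros)

lemma C_tri_0_snd: "continuous_on {a..b} u \<Longrightarrow> (\<lambda>x y. u y) \<in> C_tri a b 0"
  by (auto simp: case_prod_beta intro!: continuous_on_compose2[of "{a..b}" u] continuous_intros)

lemma C_tri_0_mult: "f \<in> C_tri a b 0 \<Longrightarrow> g \<in> C_tri a b 0 \<Longrightarrow> (\<lambda>x y. f x y * g x y) \<in> C_tri a b 0"
  by (auto simp: case_prod_beta intro!: continuous_intros)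

lemma C_tri_0_add: "f \<in> C_tri a b 0 \<Longrightarrow> g \<in> C_tri a b 0 \<Longrightarrow> (\<lambda>x y. f x y + g x y) \<in> C_tri a b 0"
  by (auto simp: case_prod_beta intro!: continuous_intros)

lemma C_tri_0_bounded:
  assumes "f \<in> C_tri a b 0"
  obtains M where "0 \<le> M" "\<And>x y. a \<le> y \<Longrightarrow> y \<le> x \<Longrightarrow> x \<le> b \<Longrightarrow> norm (f x y) \<le> M"
proof -
  have "triangle a b = cbox (a, a) (b, b) \<inter> {p. snd p \<le> fst p}"
    by (auto simp: triangle_def cbox_Pair_eq)
  moreover have "closed {p :: real \<times> real. snd p \<le> fst p}"
    by (intro closed_Collect_le continuous_intros)
  ultimately have "compact (triangle a b)" by (simp add: compact_Int_closed)
  then have "compact ((\<lambda>(x, y). f x y) ` triangle a b)"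
    using assms by (intro compact_continuous_image) auto
  then have "bounded ((\<lambda>(x, y). f x y) ` triangle a b)" by (rule compact_imp_bounded)
  then obtain B where B: "\<forall>w\<in>(\<lambda>(x, y). f x y) ` triangle a b. norm w \<le> B"
    using bounded_iff by blast
  have "norm (f x y) \<le> max 0 B" if "a \<le> y" "y \<le> x" "x \<le> b" for x y
  proof -
    have "f x y \<in> (\<lambda>(x, y). f x y) ` triangle a b"
      using that by (intro image_eqI[of _ _ "(x, y)"]) auto
    then have "norm (f x y) \<le> B" using B by blast
    then show ?thesis by simp
  qed
  then show ?thesis by (intro that[of "max 0 B"]) auto
qed

lemma kcomp_integrand_cont:
  assumes "f \<in> C_tri a b 0" "g \<in> C_tri a b 0" "a \<le> y" "x \<le> b"
  shows "continuous_on {y..x} (\<lambda>z. f x z * g z y)"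
  using assms by (intro continuous_intros C_tri_0_compose) auto

lemma kcomp_cong:
  assumes "\<And>z. y \<le> z \<Longrightarrow> z \<le> x \<Longrightarrow> f x z = f' x z" "\<And>z. y \<le> z \<Longrightarrow> z \<le> x \<Longrightarrow> g z y = g' z y"
  shows "kcomp f g x y = kcomp f' g' x y"
  unfolding kcomp_def by (rule integral_cong) (use assms in auto)

text \<open>The substitution \<open>z = y + s (x - y)\<close> moves the variable limits of the integral into the integrand.\<close>

lemma kcomp_C_tri_0:
  assumes f: "f \<in> C_tri a b 0" and g: "g \<in> C_tri a b 0"
  shows "kcomp f g \<in> C_tri a b 0"
proof -
  let ?m = "\<lambda>x y s :: real. y + s * (x - y)"
  define F where "F = (\<lambda>(p :: real \<times> real) s. f (fst p) (?m (fst p) (snd p) s) * g (?m (fst p) (snd p) s) (snd p))"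
  have sub: "kcomp f g x y = of_real (x - y) * integral {0..1} (F (x, y))"
    if "a \<le> y" "y \<le> x" "x \<le> b" for x y
  proof -
    have "((\<lambda>s. (x - y) *\<^sub>R (\<lambda>z. f x z * g z y) (?m x y s)) has_integral
        (integral {?m x y 0..?m x y 1} (\<lambda>z. f x z * g z y))) {0..1}"
    proof (rule has_integral_substitution)
      show "?m x y ` {0..1} \<subseteq> {y..x}"
        using that by (auto intro: mult_left_le_one_le) (metis add.commute add_le_cancel_right
            diff_add_cancel diff_ge_0_iff_ge mult_left_le_one_le)
      show "continuous_on {y..x} (\<lambda>z. f x z * g z y)"
        using that by (intro kcomp_integrand_cont[OF f g]) auto
      show "(?m x y has_field_derivative (x - y)) (at s within {0..1})" for s
        by (auto intro!: derivative_eq_intros)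
    qed (use that in auto)
    then have "integral {0..1} (\<lambda>s. (x - y) *\<^sub>R F (x, y) s) = kcomp f g x y"
      by (intro integral_unique) (simp add: F_def kcomp_def)
    then show ?thesis by (simp add: scaleR_conv_of_real)
  qed
  have m: "y \<le> ?m x y s \<and> ?m x y s \<le> x" if "y \<le> x" "0 \<le> s" "s \<le> 1" for x y s
  proof -
    have "s * (x - y) \<le> 1 * (x - y)" by (rule mult_right_mono) (use that in auto)
    then show ?thesis using that by auto
  qed
  have "continuous_on (triangle a b \<times> cbox 0 1) (\<lambda>q. f (fst (fst q)) (?m (fst (fst q)) (snd (fst q)) (snd q))
      * g (?m (fst (fst q)) (snd (fst q)) (snd q)) (snd (fst q)))"
    by (intro continuous_on_mult C_tri_0_compose[OF f] C_tri_0_compose[OF g] continuous_intros)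
       (auto simp: m[THEN conjunct1] m[THEN conjunct2] intro: order_trans[OF _ m[THEN conjunct1]] order_trans[OF m[THEN conjunct2]])
  then have "continuous_on (triangle a b \<times> cbox 0 1) (\<lambda>(p, s). F p s)"
    by (simp add: F_def case_prod_beta)
  then have "continuous_on (triangle a b) (\<lambda>p. integral (cbox 0 1) (F p))"
    by (rule integral_continuous_on_param)
  then have "continuous_on (triangle a b) (\<lambda>p. of_real (fst p - snd p) * integral {0..1} (F p))"
    by (auto intro!: continuous_intros)
  then have "continuous_on (triangle a b) (\<lambda>(x, y). kcomp f g x y)"
    by (rule continuous_on_eq) (auto simp: sub)
  then show ?thesis by simp
qed

text \<open>Fubini for a continuous function on a triangle. The function is extended
  continuously to the square by freezing it on the diagonal; on the square the integrals may be
  swapped, and the part that was added depends on one variable only.\<close>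

lemma integral_swap_triangle:
  fixes F :: "real \<Rightarrow> real \<Rightarrow> complex"
  assumes F: "F \<in> C_tri c d 0" and cd: "c \<le> d"
  shows "integral {c..d} (\<lambda>z. integral {c..z} (F z)) = integral {c..d} (\<lambda>s. integral {s..d} (\<lambda>z. F z s))"
proof -
  define G where "G = (\<lambda>z s. F (max z s) s)"
  define D where "D = (\<lambda>s. F s s)"
  have Gc: "continuous_on S (\<lambda>q. G (u q) (v q))" 
    if "continuous_on S u" "continuous_on S v" "\<And>q. q \<in> S \<Longrightarrow> u q \<in> {c..d} \<and> v q \<in> {c..d}" for S :: "'x::topological_space set" and u v
    unfolding G_def by (intro C_tri_0_compose[OF F] continuous_intros that) (use that in auto)
  have Dc: "continuous_on {c..d} D"
    unfolding D_def by (intro C_tri_0_compose[OF F] continuous_intros) auto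
  have swap: "integral {c..d} (\<lambda>z. integral {c..d} (G z)) = integral {c..d} (\<lambda>s. integral {c..d} (\<lambda>z. G z s))"
  proof -
    have "continuous_on (cbox (c, c) (d, d)) (\<lambda>q. G (fst q) (snd q))"
      by (intro Gc continuous_intros) auto
    then show ?thesis using integral_swap_continuous[of c c d d G] by (simp add: case_prod_beta)
  qed
  have l: "integral {c..z} (F z) = integral {c..d} (G z) - integral {z..d} D" if "z \<in> {c..d}" for z
  proof -
    have "integral {c..z} (G z) + integral {z..d} (G z) = integral {c..d} (G z)"
      using that by (intro Henstock_Kurzweil_Integration.integral_combine integrable_continuous_real Gc continuous_intros) auto
    moreover have "integral {c..z} (G z) = integral {c..z} (F z)"
      by (rule integral_cong) (auto simp: G_def max_def)
    moreover have "integral {z..d} (G z) = integral {z..d} D"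
      by (rule integral_cong) (auto simp: G_def D_def max_def)
    ultimately show ?thesis by (simp add: algebra_simps)
  qed
  have r: "integral {s..d} (\<lambda>z. F z s) = integral {c..d} (\<lambda>z. G z s) - of_real (s - c) * D s" if "s \<in> {c..d}" for s
  proof -
    have "integral {c..s} (\<lambda>z. G z s) + integral {s..d} (\<lambda>z. G z s) = integral {c..d} (\<lambda>z. G z s)"
      using that by (intro Henstock_Kurzweil_Integration.integral_combine integrable_continuous_real Gc continuous_intros) auto
    moreover have "integral {c..s} (\<lambda>z. G z s) = integral {c..s} (\<lambda>z. D s)"
      by (rule integral_cong) (auto simp: G_def D_def max_def)
    moreover have "integral {s..d} (\<lambda>z. G z s) = integral {s..d} (\<lambda>z. F z s)"
      by (rule integral_cong) (auto simp: G_def max_def)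
    ultimately show ?thesis using that by (simp add: algebra_simps scaleR_conv_of_real)
  qed
  \<comment> \<open>Integration by parts: the boundary terms of \<open>(z - c) \<integral>\<^sub>z\<^sup>d D\<close> vanish.\<close>
  have tail: "integral {c..d} (\<lambda>z. integral {z..d} D) = integral {c..d} (\<lambda>s. of_real (s - c) * D s)"
  proof -
    let ?I = "\<lambda>z. integral {z..d} D"
    have I: "(?I has_vector_derivative - D z) (at z within {c..d})" if "z \<in> {c..d}" for z
      using integral_has_vector_derivative'[OF Dc that] .
    have "((\<lambda>z. ?I z - of_real (z - c) * D z) has_integral
        (of_real (d - c) * ?I d - of_real (c - c) * ?I c)) {c..d}"
      by (rule fundamental_theorem_of_calculus[OF cd])
         (auto intro!: derivative_eq_intros I simp: scaleR_conv_of_real)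
    then have "integral {c..d} (\<lambda>z. ?I z - of_real (z - c) * D z) = 0"
      by (auto dest: integral_unique)
    moreover have "?I integrable_on {c..d}"
      using I by (intro integrable_continuous_real continuous_on_vector_derivative) auto
    ultimately show ?thesis
      using Dc by (subst (asm) integral_diff) (auto intro!: integrable_continuous_real continuous_intros)
  qed
  have I1: "(\<lambda>z. integral {c..d} (G z)) integrable_on {c..d}"
  proof (intro integrable_continuous_real)
    have "continuous_on {c..d} (\<lambda>z. integral (cbox c d) (G z))"
      by (rule integral_continuous_on_param) (auto simp: case_prod_beta intro!: Gc continuous_intros)
    then show "continuous_on {c..d} (\<lambda>z. integral {c..d} (G z))" by simp
  qed
  have I2: "(\<lambda>s. integral {c..d} (\<lambda>z. G z s)) integrable_on {c..d}"
  proof (intro integrable_continuous_real)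
    have "continuous_on {c..d} (\<lambda>z. integral (cbox c d) (\<lambda>s. G s z))"
      by (rule integral_continuous_on_param) (auto simp: case_prod_beta intro!: Gc continuous_intros)
    then show "continuous_on {c..d} (\<lambda>s. integral {c..d} (\<lambda>z. G z s))" by simp
  qed
  have I3: "(\<lambda>z. integral {z..d} D) integrable_on {c..d}"
    using integral_has_vector_derivative'[OF Dc]
    by (intro integrable_continuous_real continuous_on_vector_derivative) auto
  have I4: "(\<lambda>s. of_real (s - c) * D s) integrable_on {c..d}"
    using Dc by (intro integrable_continuous_real continuous_intros) auto
  have "integral {c..d} (\<lambda>z. integral {c..z} (F z)) = integral {c..d} (\<lambda>z. integral {c..d} (G z) - integral {z..d} D)"
    by (rule integral_cong) (use l in auto)
  also have "\<dots> = integral {c..d} (\<lambda>s. integral {c..d} (\<lambda>z. G z s)) - integral {c..d} (\<lambda>s. of_real (s - c) * D s)"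
    using I1 I3 by (simp add: integral_diff swap tail)
  also have "\<dots> = integral {c..d} (\<lambda>s. integral {c..d} (\<lambda>z. G z s) - of_real (s - c) * D s)"
    using I2 I4 by (rule integral_diff[symmetric])
  also have "\<dots> = integral {c..d} (\<lambda>s. integral {s..d} (\<lambda>z. F z s))"
    by (rule integral_cong) (use r in auto)
  finally show ?thesis .
qed

text \<open>Both sides integrate the same function over the triangle \<open>y \<le> s \<le> z \<le> x\<close>.\<close>

lemma kcomp_assoc:
  assumes f: "f \<in> C_tri a b 0" and g: "g \<in> C_tri a b 0" and w: "w \<in> C_tri a b 0"
    and xy: "a \<le> y" "y \<le> x" "x \<le> b"
  shows "kcomp f (kcomp g w) x y = kcomp (kcomp f g) w x y"
proof -
  let ?F = "\<lambda>z s. f x z * g z s * w s y"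
  have "continuous_on (triangle y x) (\<lambda>q. f x (fst q) * g (fst q) (snd q) * w (snd q) y)"
    using xy by (intro continuous_on_mult C_tri_0_compose[OF f] C_tri_0_compose[OF g] C_tri_0_compose[OF w]
       continuous_intros) auto
  then have F: "?F \<in> C_tri y x 0" by (simp add: case_prod_beta)
  have "kcomp f (kcomp g w) x y = integral {y..x} (\<lambda>z. integral {y..z} (?F z))"
    unfolding kcomp_def by (simp add: mult.assoc)
  also have "\<dots> = integral {y..x} (\<lambda>s. integral {s..x} (\<lambda>z. ?F z s))"
    by (rule integral_swap_triangle[OF F]) (use xy in auto)
  also have "\<dots> = kcomp (kcomp f g) w x y"
    unfolding kcomp_def by simp
  finally show ?thesis .
qed

lemma kcomp_add_right:
  assumes "f \<in> C_tri a b 0" "g \<in> C_tri a b 0" "w \<in> C_tri a b 0" "a \<le> y" "x \<le> b"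
  shows "kcomp f (\<lambda>z y. g z y + w z y) x y = kcomp f g x y + kcomp f w x y"
  unfolding kcomp_def distrib_left
  by (intro integral_add integrable_continuous_real kcomp_integrand_cont) (use assms in auto)

lemma kcomp_add_left:
  assumes "f \<in> C_tri a b 0" "g \<in> C_tri a b 0" "w \<in> C_tri a b 0" "a \<le> y" "x \<le> b"
  shows "kcomp (\<lambda>z y. f z y + g z y) w x y = kcomp f w x y + kcomp g w x y"
  unfolding kcomp_def distrib_right
  by (intro integral_add integrable_continuous_real kcomp_integrand_cont) (use assms in auto)

lemma volt_op_eq_kcomp: "volt_op a f u x = kcomp f (\<lambda>z _. u z) x a"
  by (simp add: volt_op_def kcomp_def)

section \<open>Functions of one variable\<close>

lemma deriv_op_cong:
  assumes "\<And>x. x \<in> {a..b} \<Longrightarrow> f x = g x" "x \<in> {a..b}"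
  shows "deriv_op a b f x = deriv_op a b g x"
proof -
  have "(f has_vector_derivative d) (at x within {a..b}) \<longleftrightarrow> (g has_vector_derivative d) (at x within {a..b})" for d
    using has_vector_derivative_transform[OF assms(2), of f g d]
      has_vector_derivative_transform[OF assms(2), of g f d] assms(1) by auto
  then show ?thesis by (simp add: deriv_op_def vector_derivative_def)
qed

lemma deriv_op_funpow_cong:
  assumes "\<And>x. x \<in> {a..b} \<Longrightarrow> f x = g x" "x \<in> {a..b}"
  shows "(deriv_op a b ^^ k) f x = (deriv_op a b ^^ k) g x"
  using assms(2)
proof (induction k arbitrary: x)
  case (Suc k)
  show ?case using deriv_op_cong[OF Suc.IH Suc.prems] by simp
qed (use assms(1) in auto)

lemma deriv_op_funpow_Suc: "(deriv_op a b ^^ Suc k) f = (deriv_op a b ^^ k) (deriv_op a b f)"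
  by (simp only: funpow_Suc_right o_def)

lemma C_diff_0 [simp]: "f \<in> C_diff a b 0 \<longleftrightarrow> continuous_on {a..b} f"
  by (simp add: C_diff_def)

lemma All_le_Suc_shift: "(\<forall>k\<le>Suc n. P k) \<longleftrightarrow> P 0 \<and> (\<forall>k\<le>n. P (Suc k))"
proof (intro iffI conjI allI impI)
  fix k assume "P 0 \<and> (\<forall>k\<le>n. P (Suc k))" "k \<le> Suc n"
  then show "P k" by (cases k) auto
qed auto

lemma C_diff_Suc:
  "f \<in> C_diff a b (Suc n) \<longleftrightarrow> (\<forall>x\<in>{a..b}. f differentiable (at x within {a..b})) \<and>
     continuous_on {a..b} f \<and> deriv_op a b f \<in> C_diff a b n"
  unfolding C_diff_def mem_Collect_eq All_less_Suc2 All_le_Suc_shift deriv_op_funpow_Suc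
  by auto

lemma C_diff_cont: "f \<in> C_diff a b n \<Longrightarrow> continuous_on {a..b} f"
  by (cases n) (auto simp: C_diff_Suc)

lemma C_diff_SucD: "f \<in> C_diff a b (Suc n) \<Longrightarrow> f \<in> C_diff a b n"
  by (induction n arbitrary: f) (auto simp: C_diff_Suc)

lemma C_diff_has_derivative:
  "f \<in> C_diff a b (Suc n) \<Longrightarrow> x \<in> {a..b} \<Longrightarrow>
     (f has_vector_derivative deriv_op a b f x) (at x within {a..b})"
  by (auto simp: C_diff_Suc deriv_op_def vector_derivative_works[symmetric])

lemma C_diff_cong:
  assumes "f \<in> C_diff a b n" "\<And>x. x \<in> {a..b} \<Longrightarrow> f x = g x"
  shows "g \<in> C_diff a b n"
  using assms
proof (induction n arbitrary: f g)
  case 0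
  then show ?case by (auto intro: continuous_on_eq)
next
  case (Suc n)
  have "(g has_vector_derivative deriv_op a b f x) (at x within {a..b})" if "x \<in> {a..b}" for x
    using has_vector_derivative_transform[OF that _ C_diff_has_derivative[OF Suc.prems(1) that], of g] Suc.prems(2)
    by auto
  moreover have "deriv_op a b g \<in> C_diff a b n"
    using Suc.IH[of "deriv_op a b f" "deriv_op a b g"] Suc.prems deriv_op_cong[of a b f g]
    by (auto simp: C_diff_Suc)
  moreover have "continuous_on {a..b} g"
    using Suc.prems by (auto simp: C_diff_Suc intro: continuous_on_eq)
  ultimately show ?case
    unfolding C_diff_Suc by (blast intro: differentiableI_vector)
qed

context
  fixes a b :: real
  assumes ab: "a < b"
begin

lemma deriv_op_eq:
  "(f has_vector_derivative d) (at x within {a..b}) \<Longrightarrow> x \<in> {a..b} \<Longrightarrow> deriv_op a b f x = d"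
  unfolding deriv_op_def using vector_derivative_within_closed_interval[OF ab] by blast

lemma C_diff_SucI:
  assumes "\<And>x. x \<in> {a..b} \<Longrightarrow> (f has_vector_derivative f' x) (at x within {a..b})" "f' \<in> C_diff a b n"
  shows "f \<in> C_diff a b (Suc n)"
proof -
  have "deriv_op a b f \<in> C_diff a b n"
    using C_diff_cong[OF assms(2)] deriv_op_eq[OF assms(1)] by simp
  moreover have "continuous_on {a..b} f"
    using assms(1) by (intro continuous_on_vector_derivative) auto
  ultimately show ?thesis
    using assms(1) unfolding C_diff_Suc by (blast intro: differentiableI_vector)
qed

lemma C_diff_const: "(\<lambda>x. c) \<in> C_diff a b n"
proof (induction n arbitrary: c)
  case (Suc n)
  show ?case by (rule C_diff_SucI[OF _ Suc[of 0]]) auto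
qed auto

lemma C_diff_add:
  "f \<in> C_diff a b n \<Longrightarrow> g \<in> C_diff a b n \<Longrightarrow> (\<lambda>x. f x + g x) \<in> C_diff a b n"
proof (induction n arbitrary: f g)
  case (Suc n)
  show ?case
    by (rule C_diff_SucI[of _ "\<lambda>x. deriv_op a b f x + deriv_op a b g x"])
       (use Suc in \<open>auto intro!: has_vector_derivative_add C_diff_has_derivative simp: C_diff_Suc\<close>)
qed (auto intro: continuous_intros)

lemma C_diff_mult:
  "f \<in> C_diff a b n \<Longrightarrow> g \<in> C_diff a b n \<Longrightarrow> (\<lambda>x. f x * g x) \<in> C_diff a b n"
proof (induction n arbitrary: f g)
  case (Suc n)
  show ?case
  proof (rule C_diff_SucI)
    show "((\<lambda>x. f x * g x) has_vector_derivative f x * deriv_op a b g x + deriv_op a b f x * g x)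
        (at x within {a..b})" if "x \<in> {a..b}" for x
      using that Suc.prems by (intro has_vector_derivative_mult C_diff_has_derivative)
    show "(\<lambda>x. f x * deriv_op a b g x + deriv_op a b f x * g x) \<in> C_diff a b n"
      using Suc.prems Suc.prems[THEN C_diff_SucD] by (intro C_diff_add Suc.IH) (auto simp: C_diff_Suc)
  qed
qed (auto intro: continuous_intros)

lemma C_diff_inverse:
  "h \<in> C_diff a b n \<Longrightarrow> (\<And>x. x \<in> {a..b} \<Longrightarrow> h x \<noteq> 0) \<Longrightarrow> (\<lambda>x. 1 / h x) \<in> C_diff a b n"
proof (induction n)
  case (Suc n)
  show ?case
  proof (rule C_diff_SucI)
    show "((\<lambda>x. 1 / h x) has_vector_derivative ((- 1) * deriv_op a b h x) * (1 / h x * (1 / h x)))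
        (at x within {a..b})" if "x \<in> {a..b}" for x
    proof -
      have "((inverse \<circ> h) has_vector_derivative deriv_op a b h x * (- (inverse (h x) ^ Suc (Suc 0)))) (at x within {a..b})"
        by (rule field_vector_diff_chain_within[OF C_diff_has_derivative[OF Suc.prems(1) that]])
           (use Suc.prems that in \<open>auto intro!: derivative_eq_intros\<close>)
      then show ?thesis by (simp add: o_def field_simps)
    qed
    have h: "h \<in> C_diff a b n" using Suc.prems(1) by (rule C_diff_SucD)
    then show "(\<lambda>x. ((- 1) * deriv_op a b h x) * (1 / h x * (1 / h x))) \<in> C_diff a b n"
      using Suc by (intro C_diff_mult C_diff_const) (auto simp: C_diff_Suc)
  qed
qed (auto intro!: continuous_intros)

lemma D_space_0 [simp]: "f \<in> D_space 0 a b \<longleftrightarrow> continuous_on {a..b} f"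
  by (simp add: D_space_def)

lemma D_space_Suc:
  "f \<in> D_space (Suc n) a b \<longleftrightarrow> f \<in> C_diff a b (Suc n) \<and> f a = 0 \<and> deriv_op a b f \<in> D_space n a b"
  unfolding D_space_def All_less_Suc2 mem_Collect_eq deriv_op_funpow_Suc
  by (auto simp: C_diff_Suc)

text \<open>The form in which membership in \<open>D_space\<close> is proved by induction: the derivative may be given as
  any function that agrees with it on the interval.\<close>

lemma D_space_SucI:
  assumes "\<And>x. x \<in> {a..b} \<Longrightarrow> (f has_vector_derivative f' x) (at x within {a..b})" "f a = 0"
    "f' \<in> D_space n a b"
  shows "f \<in> D_space (Suc n) a b"
proof -
  have "f \<in> C_diff a b (Suc n)"
    using assms by (intro C_diff_SucI) (auto simp: D_space_def)
  moreover have "(deriv_op a b ^^ k) (deriv_op a b f) a = (deriv_op a b ^^ k) f' a" for k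
    using ab deriv_op_eq[OF assms(1)] by (intro deriv_op_funpow_cong) auto
  ultimately show ?thesis
    unfolding D_space_Suc using assms by (auto simp: D_space_def C_diff_Suc)
qed

lemma D_space_Suc_subset: "f \<in> D_space (Suc n) a b \<Longrightarrow> f \<in> D_space n a b"
  by (auto simp: D_space_def dest: C_diff_SucD)

lemma D_space_le: "f \<in> D_space n a b \<Longrightarrow> m \<le> n \<Longrightarrow> f \<in> D_space m a b"
  by (induction n arbitrary: m) (auto simp: le_Suc_eq dest: D_space_Suc_subset)

lemma D_space_add:
  "f \<in> D_space n a b \<Longrightarrow> g \<in> D_space n a b \<Longrightarrow> (\<lambda>x. f x + g x) \<in> D_space n a b"
proof (induction n arbitrary: f g)
  case (Suc n)
  show ?case
    by (rule D_space_SucI[of _ "\<lambda>x. deriv_op a b f x + deriv_op a b g x"])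
       (use Suc in \<open>auto intro!: has_vector_derivative_add C_diff_has_derivative simp: D_space_Suc\<close>)
qed (auto intro: continuous_intros)

lemma D_space_funpow:
  "f \<in> D_space (k + n) a b \<Longrightarrow> (deriv_op a b ^^ k) f \<in> D_space n a b"
  by (induction k arbitrary: f) (auto simp: D_space_Suc deriv_op_funpow_Suc simp del: funpow.simps)

lemma M_space_eq: "M_space a b = (\<Inter>n. D_space n a b)"
  by (auto simp: M_space_def B1_def D_space_def)

end

section \<open>Smooth functions on the triangle\<close>

context
  fixes a b :: real
  assumes ab: "a < b"
begin

lemma islimpt_triangle_bb: "(b, b) islimpt triangle a b"
  unfolding islimpt_approachable
proof (intro allI impI)
  fix e :: real assume "e > 0"
  then show "\<exists>x'\<in>triangle a b. x' \<noteq> (b, b) \<and> dist x' (b, b) < e"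
    using ab by (intro bexI[of _ "(b, max a (b - e / 2))"]) (auto simp: dist_Pair_Pair dist_real_def max_def)
qed

lemma islimpt_triangle_aa: "(a, a) islimpt triangle a b"
  unfolding islimpt_approachable
proof (intro allI impI)
  fix e :: real assume "e > 0"
  then show "\<exists>x'\<in>triangle a b. x' \<noteq> (a, a) \<and> dist x' (a, a) < e"
    using ab by (intro bexI[of _ "(min b (a + e / 2), a)"]) (auto simp: dist_Pair_Pair dist_real_def min_def)
qed

text \<open>At the corner the horizontal section is degenerate, but there \<open>pdx\<close> is the limit of its other values,
  which is the value of the continuous candidate \<open>fx\<close>.\<close>

lemma pdx_eq:
  assumes fx: "fx \<in> C_tri a b 0"
    and d: "\<And>x y. a \<le> y \<Longrightarrow> y \<le> x \<Longrightarrow> x \<le> b \<Longrightarrow> y < b \<Longrightarrow>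
       ((\<lambda>t. f t y) has_vector_derivative fx x y) (at x within {y..b})"
    and xy: "a \<le> y" "y \<le> x" "x \<le> b"
  shows "pdx a b f x y = fx x y"
proof -
  have *: "vector_derivative (\<lambda>t. f t v) (at u within {v..b}) = fx u v"
    if "a \<le> v" "v \<le> u" "u \<le> b" "v < b" for u v
    using that by (intro vector_derivative_within_closed_interval d) auto
  show ?thesis
  proof (cases "x = b \<and> y = b")
    case True
    have "((\<lambda>(u, v). fx u v) \<longlongrightarrow> (\<lambda>(u, v). fx u v) (b, b)) (at (b, b) within triangle a b)"
      using fx ab unfolding C_tri.simps(1) mem_Collect_eq continuous_on_def by (intro bspec[where x = "(b, b)"]) auto
    then have "((\<lambda>(u, v). vector_derivative (\<lambda>t. f t v) (at u within {v..b})) \<longlongrightarrow> (\<lambda>(u, v). fx u v) (b, b))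
        (at (b, b) within triangle a b)"
      by (rule Lim_transform_eventually)
         (auto simp: eventually_at_filter intro!: always_eventually *[symmetric])
    then show ?thesis
      using True islimpt_triangle_bb
      by (simp add: pdx_def) (intro tendsto_Lim, auto simp: trivial_limit_within)
  next
    case False
    then show ?thesis using * xy by (auto simp: pdx_def)
  qed
qed

lemma pdy_eq:
  assumes fy: "fy \<in> C_tri a b 0"
    and d: "\<And>x y. a \<le> y \<Longrightarrow> y \<le> x \<Longrightarrow> x \<le> b \<Longrightarrow> a < x \<Longrightarrow>
       ((\<lambda>t. f x t) has_vector_derivative fy x y) (at y within {a..x})"
    and xy: "a \<le> y" "y \<le> x" "x \<le> b"
  shows "pdy a b f x y = fy x y"
proof -
  have *: "vector_derivative (\<lambda>t. f u t) (at v within {a..u}) = fy u v"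
    if "a \<le> v" "v \<le> u" "u \<le> b" "a < u" for u v
    using that by (intro vector_derivative_within_closed_interval d) auto
  show ?thesis
  proof (cases "x = a \<and> y = a")
    case True
    have "((\<lambda>(u, v). fy u v) \<longlongrightarrow> (\<lambda>(u, v). fy u v) (a, a)) (at (a, a) within triangle a b)"
      using fy ab unfolding C_tri.simps(1) mem_Collect_eq continuous_on_def by (intro bspec[where x = "(a, a)"]) auto
    then have "((\<lambda>(u, v). vector_derivative (\<lambda>t. f u t) (at v within {a..u})) \<longlongrightarrow> (\<lambda>(u, v). fy u v) (a, a))
        (at (a, a) within triangle a b)"
      by (rule Lim_transform_eventually)
         (auto simp: eventually_at_filter intro!: always_eventually *[symmetric])
    then show ?thesis
      using True islimpt_triangle_aa
      by (simp add: pdy_def) (intro tendsto_Lim, auto simp: trivial_limit_within)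
  next
    case False
    then show ?thesis using * xy by (auto simp: pdy_def)
  qed
qed

lemma C_tri_pdx: "f \<in> C_tri a b (Suc n) \<Longrightarrow> pdx a b f \<in> C_tri a b n"
  and C_tri_pdy: "f \<in> C_tri a b (Suc n) \<Longrightarrow> pdy a b f \<in> C_tri a b n"
  by (auto simp: C_tri.simps(2))

lemma C_tri_has_pdx:
  "f \<in> C_tri a b (Suc n) \<Longrightarrow> a \<le> y \<Longrightarrow> y \<le> x \<Longrightarrow> x \<le> b \<Longrightarrow> y < b \<Longrightarrow>
     ((\<lambda>t. f t y) has_vector_derivative pdx a b f x y) (at x within {y..b})"
  by (auto simp: C_tri.simps(2) pdx_def vector_derivative_works[symmetric])

lemma C_tri_has_pdy:
  "f \<in> C_tri a b (Suc n) \<Longrightarrow> a \<le> y \<Longrightarrow> y \<le> x \<Longrightarrow> x \<le> b \<Longrightarrow> a < x \<Longrightarrow>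
     ((\<lambda>t. f x t) has_vector_derivative pdy a b f x y) (at y within {a..x})"
  by (auto simp: C_tri.simps(2) pdy_def vector_derivative_works[symmetric])

lemma C_tri_SucI_aux:
  assumes f: "f \<in> C_tri a b 0"
    and dx: "\<And>x y. a \<le> y \<Longrightarrow> y \<le> x \<Longrightarrow> x \<le> b \<Longrightarrow> y < b \<Longrightarrow>
       ((\<lambda>t. f t y) has_vector_derivative fx x y) (at x within {y..b})"
    and dy: "\<And>x y. a \<le> y \<Longrightarrow> y \<le> x \<Longrightarrow> x \<le> b \<Longrightarrow> a < x \<Longrightarrow>
       ((\<lambda>t. f x t) has_vector_derivative fy x y) (at y within {a..x})"
    and fx: "pdx a b f \<in> C_tri a b n" and fy: "pdy a b f \<in> C_tri a b n"
  shows "f \<in> C_tri a b (Suc n)"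
proof -
  have "\<forall>(x, y) \<in> triangle a b.
        (y < b \<longrightarrow> (\<lambda>t. f t y) differentiable (at x within {y..b})) \<and>
        (a < x \<longrightarrow> (\<lambda>t. f x t) differentiable (at y within {a..x}))"
    by (clarsimp simp: differentiableI_vector[OF dx] differentiableI_vector[OF dy])
  then show ?thesis using f fx fy by (simp add: C_tri.simps(2))
qed

lemma C_tri_0_cong:
  assumes "f \<in> C_tri a b 0" "\<And>x y. a \<le> y \<Longrightarrow> y \<le> x \<Longrightarrow> x \<le> b \<Longrightarrow> f x y = g x y"
  shows "g \<in> C_tri a b 0"
proof -
  have "continuous_on (triangle a b) (\<lambda>(x, y). g x y)"
    by (rule continuous_on_eq[of _ "\<lambda>(x, y). f x y"]) (use assms in auto)
  then show ?thesis by simp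
qed

lemma C_tri_cong:
  assumes "f \<in> C_tri a b n" "\<And>x y. a \<le> y \<Longrightarrow> y \<le> x \<Longrightarrow> x \<le> b \<Longrightarrow> f x y = g x y"
  shows "g \<in> C_tri a b n"
  using assms
proof (induction n arbitrary: f g)
  case 0
  then show ?case by (rule C_tri_0_cong)
next
  case (Suc n)
  have dx: "((\<lambda>t. g t y) has_vector_derivative pdx a b f x y) (at x within {y..b})"
    if "a \<le> y" "y \<le> x" "x \<le> b" "y < b" for x y
    by (rule has_vector_derivative_transform[OF _ _ C_tri_has_pdx[OF Suc.prems(1) that]])
       (use that Suc.prems(2) in auto)
  have dy: "((\<lambda>t. g x t) has_vector_derivative pdy a b f x y) (at y within {a..x})"
    if "a \<le> y" "y \<le> x" "x \<le> b" "a < x" for x y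
    by (rule has_vector_derivative_transform[OF _ _ C_tri_has_pdy[OF Suc.prems(1) that]])
       (use that Suc.prems(2) in auto)
  have fx: "pdx a b f \<in> C_tri a b n" "pdy a b f \<in> C_tri a b n"
    using Suc.prems(1) by (auto intro: C_tri_pdx C_tri_pdy)
  show ?case
  proof (rule C_tri_SucI_aux[OF _ dx dy])
    show "pdx a b g \<in> C_tri a b n"
      by (rule Suc.IH[OF fx(1)]) (use pdx_eq[OF C_tri_cont[OF fx(1)] dx] in auto)
    show "pdy a b g \<in> C_tri a b n"
      by (rule Suc.IH[OF fx(2)]) (use pdy_eq[OF C_tri_cont[OF fx(2)] dy] in auto)
    show "g \<in> C_tri a b 0" using C_tri_0_cong[OF C_tri_cont[OF Suc.prems(1)] Suc.prems(2)] .
  qed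
qed

text \<open>To show smoothness of a kernel it suffices to guess its partial derivatives; the corner cases of
  \<open>pdx\<close> and \<open>pdy\<close> need no further attention.\<close>

lemma C_tri_SucI:
  assumes f: "f \<in> C_tri a b 0"
    and dx: "\<And>x y. a \<le> y \<Longrightarrow> y \<le> x \<Longrightarrow> x \<le> b \<Longrightarrow> y < b \<Longrightarrow>
       ((\<lambda>t. f t y) has_vector_derivative fx x y) (at x within {y..b})"
    and dy: "\<And>x y. a \<le> y \<Longrightarrow> y \<le> x \<Longrightarrow> x \<le> b \<Longrightarrow> a < x \<Longrightarrow>
       ((\<lambda>t. f x t) has_vector_derivative fy x y) (at y within {a..x})"
    and fx: "fx \<in> C_tri a b n" and fy: "fy \<in> C_tri a b n"
  shows "f \<in> C_tri a b (Suc n)"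
proof (rule C_tri_SucI_aux[OF f dx dy])
  show "pdx a b f \<in> C_tri a b n"
    by (rule C_tri_cong[OF fx]) (use pdx_eq[OF C_tri_cont[OF fx] dx] in auto)
  show "pdy a b f \<in> C_tri a b n"
    by (rule C_tri_cong[OF fy]) (use pdy_eq[OF C_tri_cont[OF fy] dy] in auto)
qed

lemma C_tri_SucD: "f \<in> C_tri a b (Suc n) \<Longrightarrow> f \<in> C_tri a b n"
proof (induction n arbitrary: f)
  case (Suc n)
  show ?case
    by (rule C_tri_SucI_aux[OF C_tri_cont[OF Suc.prems] C_tri_has_pdx[OF Suc.prems] C_tri_has_pdy[OF Suc.prems]])
       (auto intro: Suc C_tri_pdx C_tri_pdy)
qed (rule C_tri_cont)

lemma B2_iff: "f \<in> B2 a b \<longleftrightarrow> (\<forall>n. f \<in> C_tri a b n)"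
proof
  assume f: "f \<in> B2 a b"
  have "g \<in> partials a b f \<Longrightarrow> g \<in> C_tri a b n" for n g
  proof (induction n arbitrary: g)
    case 0
    then show ?case using f by (auto simp: B2_def)
  next
    case (Suc n)
    then show ?case using f Suc.IH[OF partials.dx[OF Suc.prems]] Suc.IH[OF partials.dy[OF Suc.prems]]
      by (auto simp: B2_def C_tri.simps(2))
  qed
  then show "\<forall>n. f \<in> C_tri a b n" using partials.self by blast
next
  assume f: "\<forall>n. f \<in> C_tri a b n"
  have "g \<in> C_tri a b n" if "g \<in> partials a b f" for g n
    using that
  proof (induction arbitrary: n rule: partials.induct)
    case self
    then show ?case using f by blast
  next
    case (dx g)
    then show ?case by (intro C_tri_pdx)
  next
    case (dy g)
    then show ?case by (intro C_tri_pdy)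
  qed
  then have "g \<in> C_tri a b (Suc 0)" if "g \<in> partials a b f" for g
    using that by blast
  then show "f \<in> B2 a b" by (auto simp: B2_def C_tri.simps(2))
qed

lemma B2_pdx: "f \<in> B2 a b \<Longrightarrow> pdx a b f \<in> B2 a b"
  and B2_pdy: "f \<in> B2 a b \<Longrightarrow> pdy a b f \<in> B2 a b"
  unfolding B2_iff by (auto intro: C_tri_pdx C_tri_pdy)

lemma C_tri_const: "(\<lambda>x y. c) \<in> C_tri a b n"
proof (induction n arbitrary: c)
  case (Suc n)
  show ?case by (rule C_tri_SucI[OF _ _ _ Suc[of 0] Suc[of 0]]) auto
qed auto

lemma C_tri_add:
  "f \<in> C_tri a b n \<Longrightarrow> g \<in> C_tri a b n \<Longrightarrow> (\<lambda>x y. f x y + g x y) \<in> C_tri a b n"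
proof (induction n arbitrary: f g)
  case 0
  then show ?case by (rule C_tri_0_add)
next
  case (Suc n)
  show ?case
  proof (rule C_tri_SucI)
    show "(\<lambda>x y. f x y + g x y) \<in> C_tri a b 0"
      using Suc.prems by (intro C_tri_0_add C_tri_cont)
    show "((\<lambda>t. f t y + g t y) has_vector_derivative pdx a b f x y + pdx a b g x y) (at x within {y..b})"
      if "a \<le> y" "y \<le> x" "x \<le> b" "y < b" for x y
      by (intro has_vector_derivative_add C_tri_has_pdx[OF Suc.prems(1) that] C_tri_has_pdx[OF Suc.prems(2) that])
    show "((\<lambda>t. f x t + g x t) has_vector_derivative pdy a b f x y + pdy a b g x y) (at y within {a..x})"
      if "a \<le> y" "y \<le> x" "x \<le> b" "a < x" for x y
      by (intro has_vector_derivative_add C_tri_has_pdy[OF Suc.prems(1) that] C_tri_has_pdy[OF Suc.prems(2) that])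
    show "(\<lambda>x y. pdx a b f x y + pdx a b g x y) \<in> C_tri a b n"
      by (intro Suc.IH C_tri_pdx Suc.prems)
    show "(\<lambda>x y. pdy a b f x y + pdy a b g x y) \<in> C_tri a b n"
      by (intro Suc.IH C_tri_pdy Suc.prems)
  qed
qed

lemma C_tri_mult:
  "f \<in> C_tri a b n \<Longrightarrow> g \<in> C_tri a b n \<Longrightarrow> (\<lambda>x y. f x y * g x y) \<in> C_tri a b n"
proof (induction n arbitrary: f g)
  case 0
  then show ?case by (rule C_tri_0_mult)
next
  case (Suc n)
  have "f \<in> C_tri a b n" "g \<in> C_tri a b n"
    using Suc.prems by (auto dest: C_tri_SucD)
  note IH = Suc.IH[OF this(1)] Suc.IH[OF _ this(2)]
  show ?case
  proof (rule C_tri_SucI)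
    show "(\<lambda>x y. f x y * g x y) \<in> C_tri a b 0"
      using Suc.prems by (intro C_tri_0_mult C_tri_cont)
    show "((\<lambda>t. f t y * g t y) has_vector_derivative f x y * pdx a b g x y + pdx a b f x y * g x y) (at x within {y..b})"
      if "a \<le> y" "y \<le> x" "x \<le> b" "y < b" for x y
      by (intro has_vector_derivative_mult C_tri_has_pdx[OF Suc.prems(1) that] C_tri_has_pdx[OF Suc.prems(2) that])
    show "((\<lambda>t. f x t * g x t) has_vector_derivative f x y * pdy a b g x y + pdy a b f x y * g x y) (at y within {a..x})"
      if "a \<le> y" "y \<le> x" "x \<le> b" "a < x" for x y
      by (intro has_vector_derivative_mult C_tri_has_pdy[OF Suc.prems(1) that] C_tri_has_pdy[OF Suc.prems(2) that])
    show "(\<lambda>x y. f x y * pdx a b g x y + pdx a b f x y * g x y) \<in> C_tri a b n"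
      by (intro C_tri_add IH C_tri_pdx Suc.prems)
    show "(\<lambda>x y. f x y * pdy a b g x y + pdy a b f x y * g x y) \<in> C_tri a b n"
      by (intro C_tri_add IH C_tri_pdy Suc.prems)
  qed
qed

lemma C_tri_fst: "p \<in> C_diff a b n \<Longrightarrow> (\<lambda>x y. p x) \<in> C_tri a b n"
proof (induction n arbitrary: p)
  case 0
  then show ?case by (intro C_tri_0_fst) auto
next
  case (Suc n)
  show ?case
  proof (rule C_tri_SucI[where fx = "\<lambda>x y. deriv_op a b p x" and fy = "\<lambda>x y. 0"])
    show "(\<lambda>x y. p x) \<in> C_tri a b 0"
      using Suc.prems by (intro C_tri_0_fst C_diff_cont)
    show "(p has_vector_derivative deriv_op a b p x) (at x within {y..b})"
      if "a \<le> y" "y \<le> x" "x \<le> b" "y < b" for x y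
      using that by (intro has_vector_derivative_within_subset[OF C_diff_has_derivative[OF Suc.prems]]) auto
    show "(\<lambda>x y. deriv_op a b p x) \<in> C_tri a b n"
      using Suc by (auto simp: C_diff_Suc)
  qed (auto intro: C_tri_const)
qed

lemma C_tri_snd: "p \<in> C_diff a b n \<Longrightarrow> (\<lambda>x y. p y) \<in> C_tri a b n"
proof (induction n arbitrary: p)
  case 0
  then show ?case by (intro C_tri_0_snd) auto
next
  case (Suc n)
  show ?case
  proof (rule C_tri_SucI[where fy = "\<lambda>x y. deriv_op a b p y" and fx = "\<lambda>x y. 0"])
    show "(\<lambda>x y. p y) \<in> C_tri a b 0"
      using Suc.prems by (intro C_tri_0_snd C_diff_cont)
    show "(p has_vector_derivative deriv_op a b p y) (at y within {a..x})"
      if "a \<le> y" "y \<le> x" "x \<le> b" "a < x" for x y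
      using that by (intro has_vector_derivative_within_subset[OF C_diff_has_derivative[OF Suc.prems]]) auto
    show "(\<lambda>x y. deriv_op a b p y) \<in> C_tri a b n"
      using Suc by (auto simp: C_diff_Suc)
  qed (auto intro: C_tri_const)
qed

lemma pdx_has_integral:
  assumes f: "f \<in> C_tri a b (Suc 0)" and xy: "a \<le> y" "y \<le> x" "x \<le> b"
  shows "((\<lambda>t. pdx a b f t y) has_integral (f x y - f y y)) {y..x}"
proof (cases "y = x")
  case False
  show ?thesis
    by (rule fundamental_theorem_of_calculus)
       (use xy False in \<open>auto intro!: has_vector_derivative_within_subset[OF C_tri_has_pdx[OF f]]\<close>)
qed auto

lemma pdy_has_integral:
  assumes f: "f \<in> C_tri a b (Suc 0)" and xy: "a \<le> y" "y \<le> x" "x \<le> b"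
  shows "((\<lambda>t. pdy a b f x t) has_integral (f x x - f x y)) {y..x}"
proof (cases "y = x")
  case False
  show ?thesis
    by (rule fundamental_theorem_of_calculus)
       (use xy False in \<open>auto intro!: has_vector_derivative_within_subset[OF C_tri_has_pdy[OF f]]\<close>)
qed auto

lemma C_tri_0_near_diagonal:
  assumes g: "g \<in> C_tri a b 0" and x: "a \<le> x" "x \<le> b" and e: "0 < e"
  obtains \<delta> where "0 < \<delta>"
    "\<And>p q. a \<le> q \<Longrightarrow> q \<le> p \<Longrightarrow> p \<le> b \<Longrightarrow> \<bar>p - x\<bar> < \<delta> \<Longrightarrow> \<bar>q - x\<bar> < \<delta> \<Longrightarrow> norm (g p q - g x x) < e"
proof -
  have "(x, x) \<in> triangle a b" using x by auto
  then obtain d where d: "d > 0" "\<forall>w\<in>triangle a b. dist w (x, x) < d \<longrightarrow> dist ((\<lambda>(x, y). g x y) w) (g x x) < e"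
    using g e unfolding C_tri.simps(1) mem_Collect_eq continuous_on_iff by fastforce
  show ?thesis
  proof
    show "0 < d / 2" using d by auto
    fix p q assume pq: "a \<le> q" "q \<le> p" "p \<le> b" "\<bar>p - x\<bar> < d / 2" "\<bar>q - x\<bar> < d / 2"
    have "dist (p, q) (x, x) \<le> \<bar>p - x\<bar> + \<bar>q - x\<bar>"
      unfolding dist_Pair_Pair dist_real_def using sqrt_sum_squares_le_sum_abs[of "\<bar>p - x\<bar>" "\<bar>q - x\<bar>"] by simp
    also have "\<dots> < d" using pq by auto
    finally show "norm (g p q - g x x) < e"
      using bspec[OF d(2), of "(p, q)"] pq by (auto simp: dist_norm)
  qed
qed

text \<open>The function need not extend differentiably beyond the triangle, so that the chain rule is not
  applicable on the diagonal. For \<open>u \<le> v\<close> the increment from \<open>(u,u)\<close> to \<open>(v,v)\<close> is taken along the path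
  through \<open>(v,u)\<close>, which stays in the triangle and close to the diagonal point.\<close>

lemma diagonal_has_derivative:
  assumes f: "f \<in> C_tri a b (Suc 0)" and x: "x \<in> {a..b}"
  shows "((\<lambda>x. f x x) has_vector_derivative pdx a b f x x + pdy a b f x x) (at x within {a..b})"
proof -
  let ?L = "pdx a b f x x + pdy a b f x x"
  have split: "((\<lambda>t. pdx a b f t u + pdy a b f v t) has_integral (f v v - f u u)) {u..v}"
    if "a \<le> u" "u \<le> v" "v \<le> b" for u v
    using has_integral_add[OF pdx_has_integral[OF f that] pdy_has_integral[OF f that]] by simp
  have "\<exists>d>0. \<forall>y\<in>{a..b}. norm (y - x) < d \<longrightarrow> norm (f y y - f x x - (y - x) *\<^sub>R ?L) \<le> e * norm (y - x)"
    if e: "e > 0" for e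
  proof -
    have e2: "0 < e / 2" using e by simp
    obtain d1 where d1: "0 < d1" "\<And>p q. a \<le> q \<Longrightarrow> q \<le> p \<Longrightarrow> p \<le> b \<Longrightarrow> \<bar>p - x\<bar> < d1 \<Longrightarrow> \<bar>q - x\<bar> < d1 \<Longrightarrow>
        norm (pdx a b f p q - pdx a b f x x) < e / 2"
      using C_tri_0_near_diagonal[OF C_tri_pdx[OF f] _ _ e2, of x] x by auto
    obtain d2 where d2: "0 < d2" "\<And>p q. a \<le> q \<Longrightarrow> q \<le> p \<Longrightarrow> p \<le> b \<Longrightarrow> \<bar>p - x\<bar> < d2 \<Longrightarrow> \<bar>q - x\<bar> < d2 \<Longrightarrow>
        norm (pdy a b f p q - pdy a b f x x) < e / 2"
      using C_tri_0_near_diagonal[OF C_tri_pdy[OF f] _ _ e2, of x] x by auto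
    have bound: "norm (f v v - f u u - (v - u) *\<^sub>R ?L) \<le> e * (v - u)"
      if uv: "a \<le> u" "u \<le> v" "v \<le> b" and near: "\<bar>u - x\<bar> < min d1 d2" "\<bar>v - x\<bar> < min d1 d2" for u v
    proof -
      have "((\<lambda>t. pdx a b f t u + pdy a b f v t - ?L) has_integral (f v v - f u u - (v - u) *\<^sub>R ?L)) {u..v}"
        using has_integral_diff[OF split[OF uv] has_integral_const_real[of ?L u v]] uv by simp
      then have "norm (f v v - f u u - (v - u) *\<^sub>R ?L) \<le> e * measure lborel {u..v}"
      proof (rule has_integral_bound_real[where S = "{}", rotated 2])
        fix t assume t: "t \<in> {u..v} - {}"
        have "norm (pdx a b f t u - pdx a b f x x) < e / 2"
          by (rule d1(2)) (use t uv near in auto)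
        moreover have "norm (pdy a b f v t - pdy a b f x x) < e / 2"
          by (rule d2(2)) (use t uv near in auto)
        ultimately show "norm (pdx a b f t u + pdy a b f v t - ?L) \<le> e"
          using norm_triangle_ineq[of "pdx a b f t u - pdx a b f x x" "pdy a b f v t - pdy a b f x x"]
          by (simp add: algebra_simps)
      qed (use e in auto)
      then show ?thesis using uv by simp
    qed
    show ?thesis
    proof (intro exI[of _ "min d1 d2"] conjI ballI impI)
      fix y assume y: "y \<in> {a..b}" "norm (y - x) < min d1 d2"
      show "norm (f y y - f x x - (y - x) *\<^sub>R ?L) \<le> e * norm (y - x)"
      proof (cases "x \<le> y")
        case True
        then show ?thesis using bound[of x y] x y d1 d2 by auto
      next
        case False
        have "norm (f y y - f x x - (y - x) *\<^sub>R ?L) = norm (f x x - f y y - (x - y) *\<^sub>R ?L)"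
          by (subst norm_minus_commute) (simp add: algebra_simps)
        then show ?thesis using bound[of y x] x y d1 d2 False by auto
      qed
    qed (use d1 d2 in auto)
  qed
  then show ?thesis
    unfolding has_vector_derivative_def has_derivative_within_alt
    by (auto intro: bounded_linear_scaleR_left)
qed

lemma C_tri_1: "f \<in> C_tri a b (Suc n) \<Longrightarrow> f \<in> C_tri a b (Suc 0)"
  by (induction n) (auto dest: C_tri_SucD)

lemma C_tri_diagonal: "f \<in> C_tri a b n \<Longrightarrow> (\<lambda>x. f x x) \<in> C_diff a b n"
proof (induction n arbitrary: f)
  case 0
  have "continuous_on {a..b} (\<lambda>x. f x x)"
    by (rule C_tri_0_compose[OF 0]) auto
  then show ?case by simp
next
  case (Suc n)
  show ?case
    by (rule C_diff_SucI[OF ab diagonal_has_derivative[OF C_tri_1[OF Suc.prems]]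
          C_diff_add[OF ab Suc.IH[OF C_tri_pdx[OF Suc.prems]] Suc.IH[OF C_tri_pdy[OF Suc.prems]]]])
qed

text \<open>Leibniz's rule without difference quotients. Writing \<open>f(x,z)\<close> as \<open>f(z,z)\<close> plus the composition of the
  constant kernel \<open>1\<close> with \<open>\<partial>\<^sub>x f\<close>, associativity turns \<open>kcomp f g\<close> into the integral of a continuous
  function from \<open>y\<close> to \<open>x\<close>, to which the fundamental theorem of calculus applies.\<close>

lemma kcomp_has_dx:
  assumes f: "f \<in> C_tri a b (Suc 0)" and g: "g \<in> C_tri a b 0"
    and xy: "a \<le> y" "y \<le> x" "x \<le> b"
  shows "((\<lambda>t. kcomp f g t y) has_vector_derivative f x x * g x y + kcomp (pdx a b f) g x y)
    (at x within {y..b})"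
proof -
  let ?fx = "pdx a b f" and ?one = "\<lambda>_ _ :: real. 1 :: complex"
  let ?F = "\<lambda>z. f z z * g z y + kcomp ?fx g z y"
  have fx: "?fx \<in> C_tri a b 0" using f by (rule C_tri_pdx)
  have f0: "f \<in> C_tri a b 0" using f by (rule C_tri_cont)
  have one: "?one \<in> C_tri a b 0" by (rule C_tri_const)
  have d: "(\<lambda>_ z. f z z) \<in> C_tri a b 0"
    by (intro C_tri_0_snd C_diff_cont[OF C_tri_diagonal[OF f]])
  have Fc: "continuous_on {y..b} ?F"
    using xy by (intro continuous_intros C_tri_0_compose[OF g] C_tri_0_compose[OF kcomp_C_tri_0[OF fx g]]
         C_tri_0_compose[OF f0]) auto
  have eq: "kcomp f g t y = integral {y..t} ?F" if t: "t \<in> {y..b}" for t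
  proof -
    have "f t z = f z z + kcomp ?one ?fx t z" if "y \<le> z" "z \<le> t" for z
      using pdx_has_integral[OF f, of z t] that t xy by (auto simp: kcomp_def dest!: integral_unique)
    then have "kcomp f g t y = kcomp (\<lambda>t z. f z z + kcomp ?one ?fx t z) g t y"
      by (intro kcomp_cong) auto
    also have "\<dots> = kcomp (\<lambda>t z. f z z) g t y + kcomp (kcomp ?one ?fx) g t y"
      using t xy by (intro kcomp_add_left[OF d kcomp_C_tri_0[OF one fx] g]) auto
    also have "kcomp (kcomp ?one ?fx) g t y = kcomp ?one (kcomp ?fx g) t y"
      using t xy by (intro kcomp_assoc[OF one fx g, symmetric]) auto
    also have "kcomp (\<lambda>t z. f z z) g t y + kcomp ?one (kcomp ?fx g) t y = integral {y..t} ?F"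
    proof -
      have "(\<lambda>z. f z z * g z y) integrable_on {y..t}"
        using t xy by (intro integrable_continuous_real continuous_intros C_tri_0_compose[OF g]
         C_tri_0_compose[OF f0]) auto
      moreover have "(\<lambda>z. kcomp ?fx g z y) integrable_on {y..t}"
        using t xy by (intro integrable_continuous_real continuous_intros C_tri_0_compose[OF kcomp_C_tri_0[OF fx g]]) auto
      ultimately show ?thesis
        unfolding kcomp_def[of ?one] kcomp_def[of "\<lambda>t z. f z z"] by (simp add: integral_add)
    qed
    finally show ?thesis .
  qed
  show ?thesis
    by (rule has_vector_derivative_transform[OF _ _ integral_has_vector_derivative[OF Fc]])
       (use xy eq in auto)
qed

text \<open>The mirror image of the preceding argument: \<open>g(z,y)\<close> is \<open>g(z,z)\<close> minus the composition of \<open>\<partial>\<^sub>y g\<close> with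
  the constant kernel \<open>1\<close>.\<close>

lemma kcomp_has_dy:
  assumes f: "f \<in> C_tri a b 0" and g: "g \<in> C_tri a b (Suc 0)"
    and xy: "a \<le> y" "y \<le> x" "x \<le> b"
  shows "((\<lambda>t. kcomp f g x t) has_vector_derivative - (f x y * g y y) + kcomp f (pdy a b g) x y)
    (at y within {a..x})"
proof -
  let ?gy = "pdy a b g" and ?one = "\<lambda>_ _ :: real. 1 :: complex"
  let ?G = "\<lambda>z. f x z * g z z + kcomp f (\<lambda>z s. - ?gy z s) x z"
  have gy: "?gy \<in> C_tri a b 0" using g by (rule C_tri_pdy)
  have gm: "(\<lambda>z s. - ?gy z s) \<in> C_tri a b 0"
    using C_tri_0_mult[OF C_tri_const[of "-1" 0] gy] by simp
  have g0: "g \<in> C_tri a b 0" using g by (rule C_tri_cont)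
  have one: "?one \<in> C_tri a b 0" by (rule C_tri_const)
  have d: "(\<lambda>z _. g z z) \<in> C_tri a b 0"
    by (intro C_tri_0_fst C_diff_cont[OF C_tri_diagonal[OF g]])
  have Gc: "continuous_on {a..x} ?G"
    using xy by (intro continuous_intros C_tri_0_compose[OF f] C_tri_0_compose[OF kcomp_C_tri_0[OF f gm]]
         C_tri_0_compose[OF g0]) auto
  have eq: "kcomp f g x t = integral {t..x} ?G" if t: "t \<in> {a..x}" for t
  proof -
    have "g z t = g z z + kcomp (\<lambda>z s. - ?gy z s) ?one z t" if "t \<le> z" "z \<le> x" for z
      using pdy_has_integral[OF g, of t z] that t xy by (auto simp: kcomp_def dest!: integral_unique)
    then have "kcomp f g x t = kcomp f (\<lambda>z t. g z z + kcomp (\<lambda>z s. - ?gy z s) ?one z t) x t"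
      by (intro kcomp_cong) auto
    also have "\<dots> = kcomp f (\<lambda>z t. g z z) x t + kcomp f (kcomp (\<lambda>z s. - ?gy z s) ?one) x t"
      using t xy by (intro kcomp_add_right[OF f d kcomp_C_tri_0[OF gm one]]) auto
    also have "kcomp f (kcomp (\<lambda>z s. - ?gy z s) ?one) x t = kcomp (kcomp f (\<lambda>z s. - ?gy z s)) ?one x t"
      using t xy by (intro kcomp_assoc[OF f gm one]) auto
    also have "kcomp f (\<lambda>z t. g z z) x t + kcomp (kcomp f (\<lambda>z s. - ?gy z s)) ?one x t = integral {t..x} ?G"
    proof -
      have "(\<lambda>z. f x z * g z z) integrable_on {t..x}"
        using t xy by (intro integrable_continuous_real continuous_intros C_tri_0_compose[OF g0]
         C_tri_0_compose[OF f]) auto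
      moreover have "(\<lambda>z. kcomp f (\<lambda>z s. - ?gy z s) x z) integrable_on {t..x}"
        using t xy by (intro integrable_continuous_real continuous_intros C_tri_0_compose[OF kcomp_C_tri_0[OF f gm]]) auto
      ultimately show ?thesis
        unfolding kcomp_def[of _ ?one] kcomp_def[of _ "\<lambda>t z. g t t"] by (simp add: integral_add)
    qed
    finally show ?thesis .
  qed
  have "((\<lambda>t. kcomp f g x t) has_vector_derivative - ?G y) (at y within {a..x})"
    by (rule has_vector_derivative_transform[OF _ _ integral_has_vector_derivative'[OF Gc]])
       (use xy eq in auto)
  moreover have "kcomp f (\<lambda>z s. - ?gy z s) x y = - kcomp f ?gy x y"
    by (simp add: kcomp_def)
  ultimately show ?thesis by simp
qed

lemma kcomp_C_tri:
  "f \<in> C_tri a b n \<Longrightarrow> g \<in> C_tri a b n \<Longrightarrow> kcomp f g \<in> C_tri a b n"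
proof (induction n arbitrary: f g)
  case 0
  then show ?case by (rule kcomp_C_tri_0)
next
  case (Suc n)
  have f: "(\<lambda>x. f x x) \<in> C_diff a b n" and g: "(\<lambda>x. g x x) \<in> C_diff a b n"
    using Suc.prems by (simp_all add: C_diff_SucD C_tri_diagonal)
  show ?case
  proof (rule C_tri_SucI)
    show "kcomp f g \<in> C_tri a b 0"
      using Suc.prems by (intro kcomp_C_tri_0 C_tri_cont)
    show "((\<lambda>t. kcomp f g t y) has_vector_derivative f x x * g x y + kcomp (pdx a b f) g x y)
        (at x within {y..b})" if "a \<le> y" "y \<le> x" "x \<le> b" for x y
      using that Suc.prems by (intro kcomp_has_dx C_tri_1[of f] C_tri_cont[of g])
    show "((\<lambda>t. kcomp f g x t) has_vector_derivative - 1 * (f x y * g y y) + kcomp f (pdy a b g) x y)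
        (at y within {a..x})" if "a \<le> y" "y \<le> x" "x \<le> b" for x y
      using kcomp_has_dy[OF C_tri_cont C_tri_1 that] Suc.prems by auto
    show "(\<lambda>x y. f x x * g x y + kcomp (pdx a b f) g x y) \<in> C_tri a b n"
      using Suc.prems by (intro C_tri_add C_tri_mult C_tri_fst[OF f] Suc.IH C_tri_pdx) (auto dest: C_tri_SucD)
    show "(\<lambda>x y. - 1 * (f x y * g y y) + kcomp f (pdy a b g) x y) \<in> C_tri a b n"
      using Suc.prems by (intro C_tri_add C_tri_mult C_tri_snd[OF g] C_tri_const Suc.IH C_tri_pdy) (auto dest: C_tri_SucD)
  qed
qed

end

section \<open>Calculus of Volterra operators\<close>

lemma volt_op_cong:
  assumes "\<And>z. a \<le> z \<Longrightarrow> z \<le> x \<Longrightarrow> f x z = g x z" "\<And>z. a \<le> z \<Longrightarrow> z \<le> x \<Longrightarrow> u z = v z"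
  shows "volt_op a f u x = volt_op a g v x"
  unfolding volt_op_eq_kcomp by (rule kcomp_cong) (use assms in auto)

lemma volt_op_at_start [simp]: "volt_op a f u a = 0"
  by (simp add: volt_op_def)

lemma volt_op_mult_right: "volt_op a f (\<lambda>x. S x * u x) x = volt_op a (\<lambda>x z. f x z * S z) u x"
  by (simp add: volt_op_def mult.assoc)

lemma diff_op_pad:
  assumes "r \<le> m"
  shows "diff_op a b r P \<phi> x = diff_op a b m (\<lambda>i. if i \<le> r then P i else (\<lambda>_. 0)) \<phi> x"
proof -
  have "diff_op a b m (\<lambda>i. if i \<le> r then P i else (\<lambda>_. 0)) \<phi> x
      = (\<Sum>i\<le>m. if i \<in> {..r} then P i x * (deriv_op a b ^^ i) \<phi> x else 0)"
    unfolding diff_op_def by (intro sum.cong) auto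
  also have "\<dots> = (\<Sum>i\<in>{..m} \<inter> {..r}. P i x * (deriv_op a b ^^ i) \<phi> x)"
    by (rule sum.inter_restrict[symmetric]) auto
  also have "{..m} \<inter> {..r} = {..r}" using assms by auto
  finally show ?thesis by (simp add: diff_op_def)
qed

context
  fixes a b :: real
  assumes ab: "a < b"
begin

lemma volt_op_continuous:
  assumes "f \<in> C_tri a b 0" "continuous_on {a..b} u"
  shows "continuous_on {a..b} (volt_op a f u)"
  unfolding volt_op_eq_kcomp[abs_def]
  by (rule C_tri_0_compose[OF kcomp_C_tri_0[OF assms(1) C_tri_0_fst[OF assms(2)]]]) auto

lemma volt_op_funpow_continuous:
  assumes "k \<in> C_tri a b 0" "continuous_on {a..b} u"
  shows "continuous_on {a..b} ((volt_op a k ^^ i) u)"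
  by (induction i) (auto intro: assms volt_op_continuous)

lemma volt_op_volt_op:
  assumes "f \<in> C_tri a b 0" "g \<in> C_tri a b 0" "continuous_on {a..b} u" "x \<in> {a..b}"
  shows "volt_op a f (volt_op a g u) x = volt_op a (kcomp f g) u x"
proof -
  have "volt_op a f (volt_op a g u) x = kcomp f (kcomp g (\<lambda>z _. u z)) x a"
    unfolding volt_op_eq_kcomp by (rule kcomp_cong) (auto simp: volt_op_eq_kcomp)
  also have "\<dots> = volt_op a (kcomp f g) u x"
    unfolding volt_op_eq_kcomp using assms by (intro kcomp_assoc C_tri_0_fst) auto
  finally show ?thesis .
qed

lemma volt_op_add_right:
  assumes "f \<in> C_tri a b 0" "continuous_on {a..b} u" "continuous_on {a..b} v" "x \<in> {a..b}"
  shows "volt_op a f (\<lambda>x. u x + v x) x = volt_op a f u x + volt_op a f v x"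
  unfolding volt_op_eq_kcomp using assms by (intro kcomp_add_right C_tri_0_fst) auto

lemma volt_op_add_left:
  assumes "f \<in> C_tri a b 0" "g \<in> C_tri a b 0" "continuous_on {a..b} u" "x \<in> {a..b}"
  shows "volt_op a (\<lambda>x z. f x z + g x z) u x = volt_op a f u x + volt_op a g u x"
  unfolding volt_op_eq_kcomp using assms by (intro kcomp_add_left C_tri_0_fst) auto

lemma volt_op_sum_right:
  assumes "f \<in> C_tri a b 0" "\<And>i. i \<in> I \<Longrightarrow> continuous_on {a..b} (u i)" "x \<in> {a..b}" "finite I"
  shows "volt_op a f (\<lambda>x. \<Sum>i\<in>I. u i x) x = (\<Sum>i\<in>I. volt_op a f (u i) x)"
  using assms(4,2)
proof (induction I rule: finite_induct)
  case empty
  then show ?case by (simp add: volt_op_def)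
next
  case (insert i I)
  have "continuous_on {a..b} (\<lambda>x. \<Sum>i\<in>I. u i x)"
    using insert.prems by (intro continuous_on_sum) auto
  then show ?case
    using volt_op_add_right[OF assms(1), of "u i" "\<lambda>x. \<Sum>i\<in>I. u i x" x] insert assms(3) by simp
qed

lemma volt_op_has_derivative:
  assumes "f \<in> C_tri a b (Suc 0)" "continuous_on {a..b} u" "x \<in> {a..b}"
  shows "(volt_op a f u has_vector_derivative f x x * u x + volt_op a (pdx a b f) u x)
    (at x within {a..b})"
  unfolding volt_op_eq_kcomp[abs_def]
  using kcomp_has_dx[OF ab assms(1) C_tri_0_fst[OF assms(2)], of a x] assms(3) by simp

text \<open>Integration by parts; the boundary term at \<open>a\<close> vanishes together with \<open>\<phi>\<close>.\<close>

lemma volt_op_deriv: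
  assumes f: "f \<in> C_tri a b (Suc 0)" and \<phi>: "\<phi> \<in> D_space (Suc 0) a b" and x: "x \<in> {a..b}"
  shows "volt_op a f (deriv_op a b \<phi>) x = f x x * \<phi> x + volt_op a (\<lambda>x z. - pdy a b f x z) \<phi> x"
proof (cases "x = a")
  case True
  then show ?thesis using \<phi> by (simp add: D_space_Suc[OF ab])
next
  case False
  have \<phi>': "\<phi> \<in> C_diff a b (Suc 0)" "\<phi> a = 0" and c: "continuous_on {a..b} (deriv_op a b \<phi>)"
    using \<phi> by (auto simp: D_space_Suc[OF ab] D_space_0[OF ab])
  have f0: "f \<in> C_tri a b 0" using f by (rule C_tri_cont)
  have fy: "pdy a b f \<in> C_tri a b 0" using f by (rule C_tri_pdy[OF ab])
  have "((\<lambda>z. f x z * deriv_op a b \<phi> z + pdy a b f x z * \<phi> z) has_integral (f x x * \<phi> x - f x a * \<phi> a)) {a..x}"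
  proof (rule fundamental_theorem_of_calculus)
    fix z assume z: "z \<in> {a..x}"
    show "((\<lambda>z. f x z * \<phi> z) has_vector_derivative f x z * deriv_op a b \<phi> z + pdy a b f x z * \<phi> z) (at z within {a..x})"
    proof (rule has_vector_derivative_mult)
      show "(f x has_vector_derivative pdy a b f x z) (at z within {a..x})"
        using z x False by (intro C_tri_has_pdy[OF ab f]) auto
      show "(\<phi> has_vector_derivative deriv_op a b \<phi> z) (at z within {a..x})"
        using z x by (intro has_vector_derivative_within_subset[OF C_diff_has_derivative[OF \<phi>'(1)]]) auto
    qed
  qed (use x in auto)
  then have "integral {a..x} (\<lambda>z. f x z * deriv_op a b \<phi> z + pdy a b f x z * \<phi> z) = f x x * \<phi> x"
    using \<phi>' by (auto dest: integral_unique)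
  moreover have "(\<lambda>z. f x z * deriv_op a b \<phi> z) integrable_on {a..x}"
    using x kcomp_integrand_cont[OF f0 C_tri_0_fst[OF c], of a x] by (auto intro: integrable_continuous_real)
  moreover have "(\<lambda>z. pdy a b f x z * \<phi> z) integrable_on {a..x}"
    using x kcomp_integrand_cont[OF fy C_tri_0_fst[OF C_diff_cont[OF \<phi>'(1)]], of a x] by (auto intro: integrable_continuous_real)
  ultimately have "integral {a..x} (\<lambda>z. f x z * deriv_op a b \<phi> z) + integral {a..x} (\<lambda>z. pdy a b f x z * \<phi> z) = f x x * \<phi> x"
    by (simp add: integral_add)
  then show ?thesis unfolding volt_op_def by (simp add: algebra_simps)
qed

subsection \<open>Smooth coefficients and kernels\<close>

lemma B1_const: "(\<lambda>x. c) \<in> B1 a b"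
  using C_diff_const[OF ab] by (auto simp: B1_def)

lemma B1_add: "f \<in> B1 a b \<Longrightarrow> g \<in> B1 a b \<Longrightarrow> (\<lambda>x. f x + g x) \<in> B1 a b"
  using C_diff_add[OF ab] by (auto simp: B1_def)

lemma B1_mult: "f \<in> B1 a b \<Longrightarrow> g \<in> B1 a b \<Longrightarrow> (\<lambda>x. f x * g x) \<in> B1 a b"
  using C_diff_mult[OF ab] by (auto simp: B1_def)

lemma B2_add: "f \<in> B2 a b \<Longrightarrow> g \<in> B2 a b \<Longrightarrow> (\<lambda>x y. f x y + g x y) \<in> B2 a b"
  using C_tri_add[OF ab] by (auto simp: B2_iff[OF ab])

lemma B2_const: "(\<lambda>x y. c) \<in> B2 a b"
  using C_tri_const[OF ab] by (auto simp: B2_iff[OF ab])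

lemma B2_mult_fst: "p \<in> B1 a b \<Longrightarrow> f \<in> B2 a b \<Longrightarrow> (\<lambda>x y. p x * f x y) \<in> B2 a b"
  using C_tri_mult[OF ab C_tri_fst[OF ab]] by (auto simp: B1_def B2_iff[OF ab])

lemma B2_mult_snd: "f \<in> B2 a b \<Longrightarrow> p \<in> B1 a b \<Longrightarrow> (\<lambda>x y. f x y * p y) \<in> B2 a b"
  using C_tri_mult[OF ab _ C_tri_snd[OF ab]] by (auto simp: B1_def B2_iff[OF ab])

lemma B2_uminus: "f \<in> B2 a b \<Longrightarrow> (\<lambda>x y. - f x y) \<in> B2 a b"
  using B2_mult_fst[OF B1_const[of "-1"]] by simp

lemma B2_diagonal: "f \<in> B2 a b \<Longrightarrow> (\<lambda>x. f x x) \<in> B1 a b"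
  using C_tri_diagonal[OF ab] by (auto simp: B1_def B2_iff[OF ab])

lemma B2_kcomp: "f \<in> B2 a b \<Longrightarrow> g \<in> B2 a b \<Longrightarrow> kcomp f g \<in> B2 a b"
  using kcomp_C_tri[OF ab] by (auto simp: B2_iff[OF ab])

lemma B2_pdx_funpow: "f \<in> B2 a b \<Longrightarrow> (pdx a b ^^ i) f \<in> B2 a b"
  by (induction i) (auto intro: B2_pdx[OF ab])

lemma B1_cont: "p \<in> B1 a b \<Longrightarrow> continuous_on {a..b} p"
  using C_diff_cont by (auto simp: B1_def)

lemma B2_cont: "f \<in> B2 a b \<Longrightarrow> f \<in> C_tri a b 0" and B2_C_tri: "f \<in> B2 a b \<Longrightarrow> f \<in> C_tri a b n"
  unfolding B2_iff[OF ab] by blast+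

lemma D_space_cont: "\<phi> \<in> D_space n a b \<Longrightarrow> continuous_on {a..b} \<phi>"
  by (auto simp: D_space_def intro: C_diff_cont)

subsection \<open>Moving derivatives through Volterra operators\<close>

text \<open>If \<open>B = S + V\<^sub>D\<close>, then \<open>V\<^sub>k B = V\<^sub>E\<close> with \<open>E = k S + kcomp k D\<close>, and integration by parts moves one
  derivative from the argument to \<open>E\<close>. So \<open>V\<^sub>k B \<partial>\<close> is again of the form of \<open>B\<close>: each factor \<open>V\<^sub>k\<close> absorbs
  exactly one derivative.\<close>

lemma volt_op_funpow_deriv_funpow:
  assumes k: "k \<in> B2 a b" and p: "p \<in> B1 a b"
  shows "\<exists>S\<in>B1 a b. \<exists>D\<in>B2 a b. \<forall>\<phi>\<in>D_space n a b. \<forall>x\<in>{a..b}.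
    (volt_op a k ^^ n) (\<lambda>x. p x * (deriv_op a b ^^ n) \<phi> x) x = S x * \<phi> x + volt_op a D \<phi> x"
proof (induction n)
  case 0
  show ?case
    by (intro bexI[OF _ p] bexI[OF _ B2_const[of 0]]) (auto simp: volt_op_def)
next
  case (Suc n)
  then obtain S D where S: "S \<in> B1 a b" and D: "D \<in> B2 a b"
    and SD: "\<And>\<phi> x. \<phi> \<in> D_space n a b \<Longrightarrow> x \<in> {a..b} \<Longrightarrow>
      (volt_op a k ^^ n) (\<lambda>x. p x * (deriv_op a b ^^ n) \<phi> x) x = S x * \<phi> x + volt_op a D \<phi> x"
    by blast
  define E where "E = (\<lambda>x z. k x z * S z + kcomp k D x z)"
  have kS: "(\<lambda>x z. k x z * S z) \<in> B2 a b" and kD: "kcomp k D \<in> B2 a b"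
    using k S D by (auto intro: B2_mult_snd B2_kcomp)
  then have E: "E \<in> B2 a b" unfolding E_def by (rule B2_add)
  show ?case
  proof (intro bexI[OF _ B2_diagonal[OF E]] bexI[OF _ B2_uminus[OF B2_pdy[OF ab E]]] ballI)
    fix \<phi> x assume \<phi>: "\<phi> \<in> D_space (Suc n) a b" and x: "x \<in> {a..b}"
    let ?\<psi> = "deriv_op a b \<phi>"
    have \<psi>: "?\<psi> \<in> D_space n a b" using \<phi> by (simp add: D_space_Suc[OF ab])
    then have c: "continuous_on {a..b} ?\<psi>" by (rule D_space_cont)
    have "(volt_op a k ^^ Suc n) (\<lambda>x. p x * (deriv_op a b ^^ Suc n) \<phi> x) x
        = volt_op a k ((volt_op a k ^^ n) (\<lambda>x. p x * (deriv_op a b ^^ n) ?\<psi> x)) x"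
      by (simp only: deriv_op_funpow_Suc) simp
    also have "\<dots> = volt_op a k (\<lambda>x. S x * ?\<psi> x + volt_op a D ?\<psi> x) x"
      using x by (intro volt_op_cong SD[OF \<psi>]) auto
    also have "\<dots> = volt_op a k (\<lambda>x. S x * ?\<psi> x) x + volt_op a k (volt_op a D ?\<psi>) x"
      using x c by (intro volt_op_add_right B2_cont k continuous_on_mult B1_cont[OF S] volt_op_continuous D) auto
    also have "\<dots> = volt_op a (\<lambda>x z. k x z * S z) ?\<psi> x + volt_op a (kcomp k D) ?\<psi> x"
      using volt_op_volt_op[OF B2_cont[OF k] B2_cont[OF D] c x] by (simp add: volt_op_mult_right)
    also have "\<dots> = volt_op a E ?\<psi> x"
      unfolding E_def using x c kS kD by (intro volt_op_add_left[symmetric] B2_cont) auto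
    also have "\<dots> = E x x * \<phi> x + volt_op a (\<lambda>x z. - pdy a b E x z) \<phi> x"
      using D_space_le[OF ab \<phi>, of "Suc 0"] by (intro volt_op_deriv B2_C_tri[OF E] x) auto
    finally show "(volt_op a k ^^ Suc n) (\<lambda>x. p x * (deriv_op a b ^^ Suc n) \<phi> x) x
        = E x x * \<phi> x + volt_op a (\<lambda>x z. - pdy a b E x z) \<phi> x" .
  qed
qed

text \<open>Derivatives that are left over move through the Volterra operator one at a time, each leaving
  a boundary term behind; these terms form the differential operator.\<close>

lemma volt_op_deriv_funpow:
  assumes "S \<in> B1 a b" "D \<in> B2 a b"
  shows "\<exists>P C. (\<forall>i. P i \<in> B1 a b) \<and> C \<in> B2 a b \<and> (\<forall>\<phi>\<in>D_space r a b. \<forall>x\<in>{a..b}.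
    S x * (deriv_op a b ^^ r) \<phi> x + volt_op a D ((deriv_op a b ^^ r) \<phi>) x
      = diff_op a b r P \<phi> x + volt_op a C \<phi> x)"
  using assms
proof (induction r arbitrary: S D)
  case 0
  then show ?case by (intro exI[of _ "\<lambda>_. S"] exI[of _ D]) (auto simp: diff_op_def)
next
  case (Suc r)
  have "(\<lambda>x. D x x) \<in> B1 a b" "(\<lambda>x z. - pdy a b D x z) \<in> B2 a b"
    using Suc.prems by (auto intro: B2_diagonal B2_uminus B2_pdy[OF ab])
  from Suc.IH[OF this] obtain P C where P: "\<And>i. P i \<in> B1 a b" and C: "C \<in> B2 a b"
    and PC: "\<And>\<phi> x. \<phi> \<in> D_space r a b \<Longrightarrow> x \<in> {a..b} \<Longrightarrow>
      D x x * (deriv_op a b ^^ r) \<phi> x + volt_op a (\<lambda>x z. - pdy a b D x z) ((deriv_op a b ^^ r) \<phi>) x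
      = diff_op a b r P \<phi> x + volt_op a C \<phi> x"
    by blast
  define Q where "Q = P(Suc r := S)"
  have Q: "Q i \<in> B1 a b" for i using P Suc.prems by (simp add: Q_def)
  have "S x * (deriv_op a b ^^ Suc r) \<phi> x + volt_op a D ((deriv_op a b ^^ Suc r) \<phi>) x
      = diff_op a b (Suc r) Q \<phi> x + volt_op a C \<phi> x"
    if \<phi>: "\<phi> \<in> D_space (Suc r) a b" and x: "x \<in> {a..b}" for \<phi> x
  proof -
    have "(deriv_op a b ^^ r) \<phi> \<in> D_space (Suc 0) a b"
      using \<phi> by (intro D_space_funpow[OF ab]) simp
    then have "volt_op a D ((deriv_op a b ^^ Suc r) \<phi>) x
      = D x x * (deriv_op a b ^^ r) \<phi> x + volt_op a (\<lambda>x z. - pdy a b D x z) ((deriv_op a b ^^ r) \<phi>) x"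
      using volt_op_deriv[OF B2_C_tri[OF Suc.prems(2)] _ x] by simp
    also have "\<dots> = diff_op a b r P \<phi> x + volt_op a C \<phi> x"
      by (rule PC[OF D_space_Suc_subset[OF ab \<phi>] x])
    finally show ?thesis by (simp add: diff_op_def Q_def)
  qed
  then show ?case using Q C by blast
qed

text \<open>The \<open>i\<close> factors \<open>V\<^sub>k\<close> absorb \<open>i\<close> of the \<open>n\<close> derivatives, and the other \<open>n - i\<close> become a
  differential operator.\<close>

lemma volt_op_funpow_deriv_funpow_le:
  assumes k: "k \<in> B2 a b" and p: "p \<in> B1 a b" and i: "i \<le> n"
  shows "\<exists>P C. (\<forall>j. P j \<in> B1 a b) \<and> C \<in> B2 a b \<and> (\<forall>\<phi>\<in>D_space n a b. \<forall>x\<in>{a..b}.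
    (volt_op a k ^^ i) (\<lambda>x. p x * (deriv_op a b ^^ n) \<phi> x) x = diff_op a b n P \<phi> x + volt_op a C \<phi> x)"
proof -
  obtain S D where S: "S \<in> B1 a b" and D: "D \<in> B2 a b"
    and SD: "\<And>\<phi> x. \<phi> \<in> D_space i a b \<Longrightarrow> x \<in> {a..b} \<Longrightarrow>
      (volt_op a k ^^ i) (\<lambda>x. p x * (deriv_op a b ^^ i) \<phi> x) x = S x * \<phi> x + volt_op a D \<phi> x"
    using volt_op_funpow_deriv_funpow[OF k p] by blast
  obtain P C where P: "\<And>i. P i \<in> B1 a b" and C: "C \<in> B2 a b"
    and PC: "\<And>\<phi> x. \<phi> \<in> D_space (n - i) a b \<Longrightarrow> x \<in> {a..b} \<Longrightarrow>
      S x * (deriv_op a b ^^ (n - i)) \<phi> x + volt_op a D ((deriv_op a b ^^ (n - i)) \<phi>) x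
      = diff_op a b (n - i) P \<phi> x + volt_op a C \<phi> x"
    using volt_op_deriv_funpow[OF S D] by blast
  have "(volt_op a k ^^ i) (\<lambda>x. p x * (deriv_op a b ^^ n) \<phi> x) x
      = diff_op a b n (\<lambda>j. if j \<le> n - i then P j else (\<lambda>_. 0)) \<phi> x + volt_op a C \<phi> x"
    if \<phi>: "\<phi> \<in> D_space n a b" and x: "x \<in> {a..b}" for \<phi> x
  proof -
    let ?\<psi> = "(deriv_op a b ^^ (n - i)) \<phi>"
    have \<psi>: "?\<psi> \<in> D_space i a b" using \<phi> i by (intro D_space_funpow[OF ab]) simp
    have "(deriv_op a b ^^ n) \<phi> = (deriv_op a b ^^ i) ?\<psi>"
      using i funpow_add[of i "n - i" "deriv_op a b"] by simp
    then have "(volt_op a k ^^ i) (\<lambda>x. p x * (deriv_op a b ^^ n) \<phi> x) x = S x * ?\<psi> x + volt_op a D ?\<psi> x"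
      using SD[OF \<psi> x] by simp
    also have "\<dots> = diff_op a b (n - i) P \<phi> x + volt_op a C \<phi> x"
      by (rule PC[OF _ x]) (rule D_space_le[OF ab \<phi>], simp)
    finally show ?thesis using diff_op_pad[of "n - i" n a b P \<phi> x] by simp
  qed
  then show ?thesis
    using P C B1_const[of 0] by (intro exI[of _ "\<lambda>j. if j \<le> n - i then P j else (\<lambda>_. 0)"] exI[of _ C]) auto
qed

lemma sum_volt_op_funpow_deriv_funpow:
  assumes k: "k \<in> B2 a b" and p: "p \<in> B1 a b" and N: "N \<le> n"
  shows "\<exists>P C. (\<forall>j. P j \<in> B1 a b) \<and> C \<in> B2 a b \<and> (\<forall>\<phi>\<in>D_space n a b. \<forall>x\<in>{a..b}.
    (\<Sum>i=1..N. (volt_op a k ^^ i) (\<lambda>x. p x * (deriv_op a b ^^ n) \<phi> x) x)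
      = diff_op a b n P \<phi> x + volt_op a C \<phi> x)"
  using N
proof (induction N)
  case 0
  show ?case
    by (intro exI[of _ "\<lambda>_ _. 0"] exI[of _ "\<lambda>_ _. 0"])
       (auto simp: diff_op_def volt_op_def B1_const B2_const)
next
  case (Suc N)
  then obtain P C where P: "\<And>i. P i \<in> B1 a b" and C: "C \<in> B2 a b"
    and PC: "\<And>\<phi> x. \<phi> \<in> D_space n a b \<Longrightarrow> x \<in> {a..b} \<Longrightarrow>
      (\<Sum>i=1..N. (volt_op a k ^^ i) (\<lambda>x. p x * (deriv_op a b ^^ n) \<phi> x) x)
      = diff_op a b n P \<phi> x + volt_op a C \<phi> x"
    using Suc_leD by blast
  obtain P' C' where P': "\<And>i. P' i \<in> B1 a b" and C': "C' \<in> B2 a b"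
    and PC': "\<And>\<phi> x. \<phi> \<in> D_space n a b \<Longrightarrow> x \<in> {a..b} \<Longrightarrow>
      (volt_op a k ^^ Suc N) (\<lambda>x. p x * (deriv_op a b ^^ n) \<phi> x) x
      = diff_op a b n P' \<phi> x + volt_op a C' \<phi> x"
    using volt_op_funpow_deriv_funpow_le[OF k p Suc.prems] by blast
  have "(\<Sum>i=1..Suc N. (volt_op a k ^^ i) (\<lambda>x. p x * (deriv_op a b ^^ n) \<phi> x) x)
      = diff_op a b n (\<lambda>j x. P j x + P' j x) \<phi> x + volt_op a (\<lambda>x z. C x z + C' x z) \<phi> x"
    if \<phi>: "\<phi> \<in> D_space n a b" and x: "x \<in> {a..b}" for \<phi> x
  proof -
    have "(\<Sum>i=1..Suc N. (volt_op a k ^^ i) (\<lambda>x. p x * (deriv_op a b ^^ n) \<phi> x) x)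
       = (\<Sum>i=1..N. (volt_op a k ^^ i) (\<lambda>x. p x * (deriv_op a b ^^ n) \<phi> x) x)
         + (volt_op a k ^^ Suc N) (\<lambda>x. p x * (deriv_op a b ^^ n) \<phi> x) x"
      by (simp del: funpow.simps)
    also have "\<dots> = diff_op a b n P \<phi> x + volt_op a C \<phi> x + (diff_op a b n P' \<phi> x + volt_op a C' \<phi> x)"
      by (simp only: PC[OF that] PC'[OF that])
    finally show ?thesis
      using volt_op_add_left[OF B2_cont[OF C] B2_cont[OF C'] D_space_cont[OF \<phi>] x]
      by (simp add: diff_op_def sum.distrib algebra_simps)
  qed
  then show ?case
    using P P' C C' by (intro exI[of _ "\<lambda>j x. P j x + P' j x"] exI[of _ "\<lambda>x z. C x z + C' x z"])
      (auto intro: B1_add B2_add)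
qed

section \<open>From the first to the second kind\<close>

text \<open>The two sides of the first equation agree at \<open>a\<close>, so that it is equivalent to its derivative.\<close>

lemma first_kind_step:
  assumes f: "f \<in> C_tri a b (Suc 0)" and \<phi>: "\<phi> \<in> D_space (Suc 0) a b" and u: "continuous_on {a..b} u"
  shows "(\<forall>x\<in>{a..b}. volt_op a f u x = \<phi> x) \<longleftrightarrow>
    (\<forall>x\<in>{a..b}. f x x * u x + volt_op a (pdx a b f) u x = deriv_op a b \<phi> x)"
    (is "?L \<longleftrightarrow> ?R")
proof
  assume L: ?L
  show ?R
  proof
    fix x assume x: "x \<in> {a..b}"
    have "(\<phi> has_vector_derivative f x x * u x + volt_op a (pdx a b f) u x) (at x within {a..b})"
      by (rule has_vector_derivative_transform[OF x _ volt_op_has_derivative[OF f u x]]) (use L in auto)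
    then show "f x x * u x + volt_op a (pdx a b f) u x = deriv_op a b \<phi> x"
      using deriv_op_eq[OF ab _ x] by simp
  qed
next
  assume R: ?R
  have \<phi>1: "\<phi> \<in> C_diff a b (Suc 0)" and \<phi>a: "\<phi> a = 0" using \<phi> by (auto simp: D_space_Suc[OF ab])
  have "((\<lambda>x. volt_op a f u x - \<phi> x) has_vector_derivative 0) (at x within {a..b})" if "x \<in> {a..b}" for x
    using has_vector_derivative_diff[OF volt_op_has_derivative[OF f u that] C_diff_has_derivative[OF \<phi>1 that]]
      R that by auto
  then obtain c where c: "\<And>x. x \<in> {a..b} \<Longrightarrow> volt_op a f u x - \<phi> x = c"
    using has_vector_derivative_zero_constant[of "{a..b}" "\<lambda>x. volt_op a f u x - \<phi> x"] convex_closed_interval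
    by (metis convex_real_interval(5))
  have "c = 0" using c[of a] ab \<phi>a by simp
  then show ?L using c by auto
qed

lemma first_kind_iff:
  assumes "f \<in> B2 a b" "\<And>i x. i < n \<Longrightarrow> x \<in> {a..b} \<Longrightarrow> (pdx a b ^^ i) f x x = 0"
    and "\<phi> \<in> D_space (Suc n) a b" and u: "continuous_on {a..b} u"
  shows "(\<forall>x\<in>{a..b}. volt_op a f u x = \<phi> x) \<longleftrightarrow>
    (\<forall>x\<in>{a..b}. (pdx a b ^^ n) f x x * u x + volt_op a ((pdx a b ^^ Suc n) f) u x
       = (deriv_op a b ^^ Suc n) \<phi> x)"
  using assms(1-3)
proof (induction n arbitrary: f \<phi>)
  case 0
  then show ?case using first_kind_step[OF B2_C_tri _ u] by simp
next
  case (Suc n)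
  have \<phi>: "\<phi> \<in> D_space (Suc 0) a b" "deriv_op a b \<phi> \<in> D_space (Suc n) a b"
    using D_space_le[OF ab Suc.prems(3), of "Suc 0"] D_space_Suc[OF ab, of \<phi> "Suc n"] Suc.prems(3) by auto
  have z: "f x x = 0" if "x \<in> {a..b}" for x
    using Suc.prems(2)[of 0 x] that by simp
  have "(\<forall>x\<in>{a..b}. volt_op a f u x = \<phi> x) \<longleftrightarrow> (\<forall>x\<in>{a..b}. volt_op a (pdx a b f) u x = deriv_op a b \<phi> x)"
    using first_kind_step[OF B2_C_tri[OF Suc.prems(1)] \<phi>(1) u] z by simp
  also have "\<dots> \<longleftrightarrow> (\<forall>x\<in>{a..b}. (pdx a b ^^ n) (pdx a b f) x x * u x
      + volt_op a ((pdx a b ^^ Suc n) (pdx a b f)) u x = (deriv_op a b ^^ Suc n) (deriv_op a b \<phi>) x)"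
  proof (rule Suc.IH[OF B2_pdx[OF ab Suc.prems(1)] _ \<phi>(2)])
    show "(pdx a b ^^ i) (pdx a b f) x x = 0" if "i < n" "x \<in> {a..b}" for i x
      using Suc.prems(2)[of "Suc i" x] that by (simp only: funpow_Suc_right o_def)
  qed
  finally show ?case by (simp only: funpow_Suc_right o_def)
qed

end

section \<open>The resolvent kernel\<close>

lemma iter_kernel_Suc: "iter_kernel k (Suc i) = kcomp k (iter_kernel k i)"
  by (simp add: kcomp_def fun_eq_iff)

lemma power_divide_fact_has_integral:
  fixes y x c :: real
  assumes "y \<le> x"
  shows "((\<lambda>z. c * ((z - y) ^ i / fact i)) has_integral c * ((x - y) ^ Suc i / fact (Suc i))) {y..x}"
proof -
  have d: "((\<lambda>z. c * ((z - y) ^ Suc i / fact (Suc i))) has_real_derivative c * ((z - y) ^ i / fact i)) (at z within S)" for z S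
  proof -
    have "((\<lambda>z. z - y) has_real_derivative 1) (at z within S)"
      by (auto intro!: derivative_eq_intros)
    from DERIV_cmult[OF DERIV_cdivide[OF DERIV_power[OF this, of "Suc i"]], of c "fact (Suc i)"]
    have "((\<lambda>z. c * ((z - y) ^ Suc i / fact (Suc i))) has_real_derivative
        c * (real (Suc i) * (z - y) ^ i / fact (Suc i))) (at z within S)"
      by simp
    moreover have "real (Suc i) * (z - y) ^ i / fact (Suc i) = (z - y) ^ i / fact i"
      by (simp add: divide_simps del: of_nat_Suc)
    ultimately show ?thesis by simp
  qed
  have "((\<lambda>z. c * ((z - y) ^ i / fact i)) has_integral
     c * ((x - y) ^ Suc i / fact (Suc i)) - c * ((y - y) ^ Suc i / fact (Suc i))) {y..x}"
    by (rule fundamental_theorem_of_calculus[OF assms])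
       (simp only: has_real_derivative_iff_has_vector_derivative[symmetric] d)
  then show ?thesis by simp
qed

lemma kcomp_norm_bound:
  assumes f: "f \<in> C_tri a b 0" and w: "w \<in> C_tri a b 0" and xy: "a \<le> y" "y \<le> x" "x \<le> b"
    and M: "\<And>z. y \<le> z \<Longrightarrow> z \<le> x \<Longrightarrow> norm (f x z) \<le> M"
    and W: "\<And>z. y \<le> z \<Longrightarrow> z \<le> x \<Longrightarrow> norm (w z y) \<le> W * ((z - y) ^ i / fact i)"
  shows "norm (kcomp f w x y) \<le> M * W * ((x - y) ^ Suc i / fact (Suc i))"
proof -
  have M0: "0 \<le> M" using M[of x] xy norm_ge_zero order_trans by blast
  note I = power_divide_fact_has_integral[OF xy(2), of "M * W" i]
  have "norm (kcomp f w x y) \<le> integral {y..x} (\<lambda>z. M * W * ((z - y) ^ i / fact i))"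
    unfolding kcomp_def
  proof (rule integral_norm_bound_integral)
    show "(\<lambda>z. f x z * w z y) integrable_on {y..x}"
      by (intro integrable_continuous_real kcomp_integrand_cont[OF f w] xy)
    show "(\<lambda>z. M * W * ((z - y) ^ i / fact i)) integrable_on {y..x}"
      using I by blast
    fix z assume "z \<in> {y..x}"
    then have "norm (f x z) * norm (w z y) \<le> M * (W * ((z - y) ^ i / fact i))"
      by (intro mult_mono M W M0) auto
    then show "norm (f x z * w z y) \<le> M * W * ((z - y) ^ i / fact i)"
      by (simp add: norm_mult mult.assoc)
  qed
  also have "\<dots> = M * W * ((x - y) ^ Suc i / fact (Suc i))"
    using I by (rule integral_unique)
  finally show ?thesis .
qed

lemma iter_kernel_C_tri_0: "k \<in> C_tri a b 0 \<Longrightarrow> iter_kernel k i \<in> C_tri a b 0"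
proof (induction i)
  case (Suc i)
  then show ?case unfolding iter_kernel_Suc by (intro kcomp_C_tri_0)
qed simp

lemma iter_kernel_bound:
  assumes k: "k \<in> C_tri a b 0"
    and M: "\<And>x y. a \<le> y \<Longrightarrow> y \<le> x \<Longrightarrow> x \<le> b \<Longrightarrow> norm (k x y) \<le> M"
    and xy: "a \<le> y" "y \<le> x" "x \<le> b"
  shows "norm (iter_kernel k i x y) \<le> M ^ Suc i * ((x - y) ^ i / fact i)"
  using xy
proof (induction i arbitrary: x)
  case 0
  then show ?case using M by simp
next
  case (Suc i)
  have "norm (kcomp k (iter_kernel k i) x y) \<le> M * M ^ Suc i * ((x - y) ^ Suc i / fact (Suc i))"
    by (rule kcomp_norm_bound[OF k iter_kernel_C_tri_0[OF k] Suc.prems])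
       (use Suc M in auto)
  then show ?case unfolding iter_kernel_Suc by simp
qed

lemma iter_kernel_uniform_bound:
  assumes k: "k \<in> C_tri a b 0"
  obtains B :: "nat \<Rightarrow> real" where "summable B"
    "\<And>i x y. a \<le> y \<Longrightarrow> y \<le> x \<Longrightarrow> x \<le> b \<Longrightarrow> norm (iter_kernel k i x y) \<le> B i"
proof -
  obtain M where M: "0 \<le> M" "\<And>x y. a \<le> y \<Longrightarrow> y \<le> x \<Longrightarrow> x \<le> b \<Longrightarrow> norm (k x y) \<le> M"
    using C_tri_0_bounded[OF k] by blast
  let ?B = "\<lambda>i. M * (inverse (fact i) * (M * (b - a)) ^ i)"
  show ?thesis
  proof
    show "summable ?B" by (intro summable_mult summable_exp)
    fix i :: nat and x y assume xy: "a \<le> y" "y \<le> x" "x \<le> b"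
    have "norm (iter_kernel k i x y) \<le> M ^ Suc i * ((x - y) ^ i / fact i)"
      by (rule iter_kernel_bound[OF k M(2) xy])
    also have "\<dots> \<le> M ^ Suc i * ((b - a) ^ i / fact i)"
      using M xy by (intro mult_left_mono divide_right_mono power_mono) auto
    also have "\<dots> = ?B i" by (simp add: power_mult_distrib divide_inverse ac_simps)
    finally show "norm (iter_kernel k i x y) \<le> ?B i" .
  qed
qed

lemma resolvent_C_tri_0:
  assumes k: "k \<in> C_tri a b 0"
  shows "resolvent k \<in> C_tri a b 0"
proof -
  obtain B :: "nat \<Rightarrow> real" where B: "summable B"
    "\<And>i x y. a \<le> y \<Longrightarrow> y \<le> x \<Longrightarrow> x \<le> b \<Longrightarrow> norm (iter_kernel k i x y) \<le> B i"
    using iter_kernel_uniform_bound[OF k] by blast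
  have ul: "uniform_limit (triangle a b) (\<lambda>n p. \<Sum>i<n. (\<lambda>(x, y). iter_kernel k i x y) p)
      (\<lambda>p. \<Sum>i. (\<lambda>(x, y). iter_kernel k i x y) p) sequentially"
    by (rule Weierstrass_m_test[OF _ B(1)]) (auto intro: B(2))
  have "continuous_on (triangle a b) (\<lambda>p. \<Sum>i<n. (\<lambda>(x, y). iter_kernel k i x y) p)" for n
    using iter_kernel_C_tri_0[OF k] by (intro continuous_on_sum) auto
  then have "continuous_on (triangle a b) (\<lambda>p. \<Sum>i. (\<lambda>(x, y). iter_kernel k i x y) p)"
    by (intro uniform_limit_theorem[OF _ ul]) auto
  then show ?thesis by (simp add: resolvent_def case_prod_beta)
qed

text \<open>The series for \<open>H\<close> without its first term is the composition of \<open>k\<close> with \<open>H\<close>, since uniform convergence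
  permits to integrate term by term.\<close>

lemma resolvent_eq:
  assumes k: "k \<in> C_tri a b 0" and xy: "a \<le> y" "y \<le> x" "x \<le> b"
  shows "resolvent k x y = k x y + kcomp k (resolvent k) x y"
proof -
  obtain B :: "nat \<Rightarrow> real" where B: "summable B"
    "\<And>i x y. a \<le> y \<Longrightarrow> y \<le> x \<Longrightarrow> x \<le> b \<Longrightarrow> norm (iter_kernel k i x y) \<le> B i"
    using iter_kernel_uniform_bound[OF k] by blast
  obtain M where M: "0 \<le> M" "\<And>x y. a \<le> y \<Longrightarrow> y \<le> x \<Longrightarrow> x \<le> b \<Longrightarrow> norm (k x y) \<le> M"
    using C_tri_0_bounded[OF k] by blast
  have sm: "summable (\<lambda>i. iter_kernel k i z y)" if "y \<le> z" "z \<le> x" for z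
    by (rule summable_comparison_test[OF _ B(1)]) (use that xy B(2) in auto)
  let ?t = "\<lambda>i z. k x z * iter_kernel k i z y"
  have tc: "continuous_on {y..x} (?t i)" for i
    by (intro kcomp_integrand_cont[OF k iter_kernel_C_tri_0[OF k]] xy)
  have "uniform_limit {y..x} (\<lambda>n z. \<Sum>i<n. ?t i z) (\<lambda>z. \<Sum>i. ?t i z) sequentially"
  proof (rule Weierstrass_m_test)
    show "summable (\<lambda>i. M * B i)" by (intro summable_mult B(1))
    show "norm (?t i z) \<le> M * B i" if "z \<in> {y..x}" for i z
      unfolding norm_mult using that xy by (intro mult_mono M B(2)) auto
  qed
  then obtain I J where I: "\<And>n. ((\<lambda>z. \<Sum>i<n. ?t i z) has_integral I n) {y..x}"
    and J: "((\<lambda>z. \<Sum>i. ?t i z) has_integral J) {y..x}" and lim: "I \<longlonglongrightarrow> J"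
    by (rule uniform_limit_integral) (auto intro!: continuous_on_sum tc)
  have "J = integral {y..x} (\<lambda>z. \<Sum>i. ?t i z)" using J by (simp add: integral_unique)
  also have "\<dots> = kcomp k (resolvent k) x y"
    unfolding kcomp_def by (rule integral_cong) (auto simp: resolvent_def suminf_mult sm)
  finally have J': "J = kcomp k (resolvent k) x y" .
  have "I = (\<lambda>n. \<Sum>i<n. iter_kernel k (Suc i) x y)"
  proof
    fix n
    have "I n = integral {y..x} (\<lambda>z. \<Sum>i<n. ?t i z)" by (rule integral_unique[OF I, symmetric])
    also have "\<dots> = (\<Sum>i<n. integral {y..x} (?t i))"
      by (intro integral_sum integrable_continuous_real tc) auto
    finally show "I n = (\<Sum>i<n. iter_kernel k (Suc i) x y)" by simp
  qed
  moreover have "(\<lambda>n. \<Sum>i<n. iter_kernel k (Suc i) x y) \<longlonglongrightarrow> (\<Sum>i. iter_kernel k (Suc i) x y)"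
    using sm[of x] xy by (intro summable_LIMSEQ, subst summable_Suc_iff) auto
  ultimately have "I \<longlonglongrightarrow> (\<Sum>i. iter_kernel k (Suc i) x y)" by simp
  with lim have "J = (\<Sum>i. iter_kernel k (Suc i) x y)" by (rule LIMSEQ_unique)
  also have "\<dots> = resolvent k x y - k x y"
    using suminf_split_head[OF sm[of x]] xy by (simp add: resolvent_def)
  finally show ?thesis using J' by simp
qed

context
  fixes a b :: real
  assumes ab: "a < b"
begin

lemma volt_op_resolvent:
  assumes k: "k \<in> C_tri a b 0" and u: "continuous_on {a..b} u" and x: "x \<in> {a..b}"
  shows "volt_op a (resolvent k) u x = volt_op a k u x + volt_op a k (volt_op a (resolvent k) u) x"
proof -
  note H = resolvent_C_tri_0[OF k]
  have "volt_op a (resolvent k) u x = volt_op a (\<lambda>x z. k x z + kcomp k (resolvent k) x z) u x"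
    using x by (intro volt_op_cong resolvent_eq[OF k]) auto
  also have "\<dots> = volt_op a k u x + volt_op a (kcomp k (resolvent k)) u x"
    by (rule volt_op_add_left[OF ab k kcomp_C_tri_0[OF k H] u x])
  finally show ?thesis using volt_op_volt_op[OF ab k H u x] by simp
qed

text \<open>A fixed point of a Volterra operator is a fixed point of all of its powers, whose norms
  tend to zero.\<close>

lemma volt_op_fixpoint_zero:
  assumes k: "k \<in> C_tri a b 0" and d: "continuous_on {a..b} d"
    and fix_d: "\<And>x. x \<in> {a..b} \<Longrightarrow> d x = volt_op a k d x" and x: "x \<in> {a..b}"
  shows "d x = 0"
proof -
  obtain M where M: "0 \<le> M" "\<And>x y. a \<le> y \<Longrightarrow> y \<le> x \<Longrightarrow> x \<le> b \<Longrightarrow> norm (k x y) \<le> M"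
    using C_tri_0_bounded[OF k] by blast
  obtain W where W: "\<forall>x\<in>{a..b}. norm (d x) \<le> W"
    using compact_imp_bounded[OF compact_continuous_image[OF d compact_Icc]] by (auto simp: bounded_iff)
  have bound: "norm (d x) \<le> M ^ i * W * ((x - a) ^ i / fact i)" if "x \<in> {a..b}" for x i
    using that
  proof (induction i arbitrary: x)
    case 0
    then show ?case using W by simp
  next
    case (Suc i)
    have "norm (kcomp k (\<lambda>z _. d z) x a) \<le> M * (M ^ i * W) * ((x - a) ^ Suc i / fact (Suc i))"
    proof (rule kcomp_norm_bound[OF k C_tri_0_fst[OF d]])
      show "norm (k x z) \<le> M" if "a \<le> z" "z \<le> x" for z
        using that Suc.prems by (intro M(2)) auto
      show "norm (d z) \<le> M ^ i * W * ((z - a) ^ i / fact i)" if "a \<le> z" "z \<le> x" for z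
        using that Suc.prems by (intro Suc.IH) auto
    qed (use Suc.prems in auto)
    then show ?case unfolding fix_d[OF Suc.prems, unfolded volt_op_eq_kcomp] by (simp only: power_Suc mult.assoc)
  qed
  let ?s = "\<lambda>i. W * (inverse (fact i) * (M * (x - a)) ^ i)"
  have lim: "?s \<longlonglongrightarrow> 0"
    using tendsto_mult_left[OF summable_LIMSEQ_zero[OF summable_exp[of "M * (x - a)"]], of W] by simp
  have le: "norm (d x) \<le> ?s i" for i
  proof -
    have "M ^ i * W * ((x - a) ^ i / fact i) = ?s i"
      by (simp add: power_mult_distrib divide_inverse ac_simps)
    then show ?thesis using bound[OF x, of i] by simp
  qed
  have "norm (d x) \<le> 0"
    by (rule tendsto_lowerbound[OF lim always_eventually[OF allI[OF le]]]) simp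
  then show ?thesis by simp
qed

text \<open>Applying \<open>V\<^sub>k\<close> shifts the powers in the sum by one. The surplus term \<open>V\<^sub>k V\<^sub>k\<^sup>n g\<close> is what \<open>V\<^sub>k V\<^sub>H\<close> lacks
  to be \<open>V\<^sub>H\<close>.\<close>

lemma second_kind_solution:
  fixes n :: nat
  assumes k: "k \<in> C_tri a b 0" and g: "continuous_on {a..b} g" and x: "x \<in> {a..b}"
  defines "y \<equiv> \<lambda>x. g x + (\<Sum>i=1..n. (volt_op a k ^^ i) g x) + volt_op a (resolvent k) ((volt_op a k ^^ n) g) x"
  shows "y x = g x + volt_op a k y x"
proof -
  let ?v = "\<lambda>i. (volt_op a k ^^ i) g" and ?H = "resolvent k"
  have v: "continuous_on {a..b} (?v i)" for i by (rule volt_op_funpow_continuous[OF ab k g])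
  have H: "continuous_on {a..b} (volt_op a ?H (?v n))"
    by (rule volt_op_continuous[OF ab resolvent_C_tri_0[OF k] v])
  have y: "y = (\<lambda>x. (\<Sum>i\<le>n. ?v i x) + volt_op a ?H (?v n) x)"
    by (simp add: y_def fun_eq_iff atMost_atLeast0 sum.atLeast_Suc_atMost[of 0 n])
  have "volt_op a k y x = volt_op a k (\<lambda>x. \<Sum>i\<le>n. ?v i x) x + volt_op a k (volt_op a ?H (?v n)) x"
    unfolding y by (intro volt_op_add_right[OF ab k] continuous_on_sum v H x)
  also have "volt_op a k (\<lambda>x. \<Sum>i\<le>n. ?v i x) x = (\<Sum>i\<le>n. ?v (Suc i) x)"
    using volt_op_sum_right[OF ab k v x, of "{..n}" "\<lambda>i. i"] by simp
  also have "\<dots> = (\<Sum>i\<le>n. ?v i x) - g x + volt_op a k (?v n) x"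
    using sum.atMost_Suc_shift[of "\<lambda>i. ?v i x" n] by (simp add: algebra_simps)
  finally have "g x + volt_op a k y x = (\<Sum>i\<le>n. ?v i x) + (volt_op a k (?v n) x + volt_op a k (volt_op a ?H (?v n)) x)"
    by simp
  also have "\<dots> = y x" using volt_op_resolvent[OF k v x] by (simp add: y)
  finally show ?thesis by simp
qed

end

section \<open>Uniqueness of the decomposition\<close>

text \<open>Flat functions at \<open>a\<close>. The negative powers of \<open>x - a\<close> are included because differentiation of
  \<open>exp(- 1 / (x - a))\<close> produces them: the derivative of a flat function is then a combination of flat
  functions.\<close>

definition rflat :: "real \<Rightarrow> nat \<Rightarrow> real \<Rightarrow> real" where
  "rflat a j x = (if x \<le> a then 0 else exp (- inverse (x - a)) * inverse (x - a) ^ j)"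

lemma rflat_tendsto: "(rflat a j \<longlongrightarrow> 0) (at_right a)"
proof -
  have "filterlim (\<lambda>x. inverse (x - a)) at_top (at_right a)"
    by (rule filterlim_inverse_at_top)
       (auto intro!: tendsto_eq_intros simp: eventually_at_filter)
  then have "((\<lambda>x. inverse (x - a) ^ j / exp (inverse (x - a))) \<longlongrightarrow> 0) (at_right a)"
    by (rule filterlim_compose[OF tendsto_power_div_exp_0])
  then show ?thesis
  proof (rule Lim_transform_eventually)
    show "\<forall>\<^sub>F x in at_right a. inverse (x - a) ^ j / exp (inverse (x - a)) = rflat a j x"
      unfolding eventually_at_filter
      by (intro always_eventually) (auto simp: rflat_def exp_minus field_simps)
  qed
qed

lemma rflat_has_derivative:
  assumes x: "x \<in> {a..b}" and ab: "a < b"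
  shows "(rflat a j has_real_derivative rflat a (j + 2) x - real j * rflat a (j + 1) x) (at x within {a..b})"
proof (cases "x = a")
  case True
  have "((\<lambda>y. (rflat a j y - rflat a j a) / (y - a)) \<longlongrightarrow> 0) (at_right a)"
  proof (rule Lim_transform_eventually[OF rflat_tendsto[of a "Suc j"]])
    show "\<forall>\<^sub>F y in at_right a. rflat a (Suc j) y = (rflat a j y - rflat a j a) / (y - a)"
      unfolding eventually_at_filter
      by (intro always_eventually) (auto simp: rflat_def divide_inverse ac_simps)
  qed
  then show ?thesis
    unfolding True has_field_derivative_iff at_within_Icc_at_right[OF ab] by (simp add: rflat_def)
next
  case False
  then have ax: "a < x" using x by auto
  let ?g = "\<lambda>t. exp (- inverse (t - a)) * inverse (t - a) ^ j" and ?s = "inverse (x - a)"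
  have s: "((\<lambda>t. inverse (t - a)) has_real_derivative - (?s ^ 2)) (at x)"
    using ax by (auto intro!: derivative_eq_intros simp: power2_eq_square)
  have "exp (- ?s) * - (- (?s ^ 2)) * ?s ^ j + real j * (- (?s ^ 2) * ?s ^ (j - Suc 0)) * exp (- ?s)
      = rflat a (j + 2) x - real j * rflat a (j + 1) x"
    using ax by (cases j) (auto simp: rflat_def power2_eq_square algebra_simps)
  then have "(?g has_real_derivative rflat a (j + 2) x - real j * rflat a (j + 1) x) (at x)"
    using DERIV_mult[OF DERIV_fun_exp[OF DERIV_minus[OF s]] DERIV_power[OF s, of j]] by simp
  then have "(rflat a j has_real_derivative rflat a (j + 2) x - real j * rflat a (j + 1) x) (at x)"
    by (rule has_field_derivative_transform_within_open[of _ _ _ "{a<..}"])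
       (use ax in \<open>auto simp: rflat_def\<close>)
  then show ?thesis by (rule has_field_derivative_at_within)
qed

text \<open>By Weierstrass's theorem the conjugate of \<open>g\<close> is a uniform limit of polynomials, so that \<open>g\<close> is
  orthogonal to itself.\<close>

lemma orthogonal_to_polynomials:
  fixes g :: "real \<Rightarrow> complex"
  assumes g: "continuous_on {a..c} g" and ac: "a < c"
    and orth: "\<And>q :: real \<Rightarrow> complex. polynomial_function q \<Longrightarrow> integral {a..c} (\<lambda>z. g z * q z) = 0"
    and z: "z \<in> {a..c}"
  shows "g z = 0"
proof -
  define I where "I = integral {a..c} (\<lambda>z. (norm (g z))\<^sup>2)"
  define K where "K = integral {a..c} (\<lambda>z. norm (g z))"
  have nonneg: "0 \<le> I" unfolding I_def by (rule integral_nonneg) (auto intro!: integrable_continuous_real continuous_intros g)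
  have "I \<le> K * e" if e: "0 < e" for e
  proof -
    obtain q where q: "polynomial_function q" "\<And>z. z \<in> {a..c} \<Longrightarrow> norm (cnj (g z) - q z) < e"
      using Stone_Weierstrass_polynomial_function[of "{a..c}" "\<lambda>z. cnj (g z)" e] e g
      by (auto intro: continuous_intros)
    have qc: "continuous_on {a..c} q" using q(1) by (rule continuous_on_polymonial_function)
    have "of_real I = integral {a..c} (\<lambda>z. g z * cnj (g z))"
      unfolding I_def complex_norm_square[symmetric]
    proof -
      have "(\<lambda>z. (norm (g z))\<^sup>2) integrable_on {a..c}"
        by (auto intro!: integrable_continuous_real continuous_intros g)
      from integral_linear[OF this bounded_linear_of_real[where 'a = complex]]
      show "of_real (integral {a..c} (\<lambda>z. (norm (g z))\<^sup>2)) = integral {a..c} (\<lambda>z. complex_of_real ((norm (g z))\<^sup>2))"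
        unfolding o_def by (rule sym)
    qed
    also have "\<dots> = integral {a..c} (\<lambda>z. g z * (cnj (g z) - q z))"
      unfolding right_diff_distrib using orth[OF q(1)] g qc
      by (subst integral_diff) (auto intro!: integrable_continuous_real continuous_intros)
    finally have "I = norm (integral {a..c} (\<lambda>z. g z * (cnj (g z) - q z)))"
      using nonneg by (metis abs_of_nonneg norm_of_real)
    also have "\<dots> \<le> integral {a..c} (\<lambda>z. norm (g z) * e)"
    proof (rule integral_norm_bound_integral)
      show "norm (g z * (cnj (g z) - q z)) \<le> norm (g z) * e" if "z \<in> {a..c}" for z
        unfolding norm_mult using q(2)[OF that] by (intro mult_left_mono) auto
    qed (auto intro!: integrable_continuous_real continuous_intros g qc)
    finally show ?thesis by (simp add: K_def)
  qed
  then have ev: "\<forall>\<^sub>F e in at_right 0. I \<le> K * e"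
    unfolding eventually_at_filter by (intro always_eventually) simp
  have "((\<lambda>e. K * e) \<longlongrightarrow> K * 0) (at_right 0)"
    by (rule tendsto_mult_left[OF tendsto_ident_at])
  from tendsto_lowerbound[OF this ev] have "I \<le> 0" by simp
  with nonneg have "I = 0" by simp
  moreover have "I = 0 \<longleftrightarrow> (\<forall>z\<in>{a..c}. (norm (g z))\<^sup>2 = 0)"
    unfolding I_def by (rule integral_eq_0_iff) (auto intro!: continuous_intros g ac)
  ultimately show ?thesis using z by simp
qed

context
  fixes a b :: real
  assumes ab: "a < b"
begin

definition flat :: "nat \<Rightarrow> real \<Rightarrow> complex" where
  "flat j x = of_real (rflat a j x)"

lemma flat_nonzero: "a < x \<Longrightarrow> flat j x \<noteq> 0"
  by (simp add: flat_def rflat_def)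

lemma flat_has_derivative:
  assumes "x \<in> {a..b}"
  shows "(flat j has_vector_derivative flat (j + 2) x - of_nat j * flat (j + 1) x) (at x within {a..b})"
proof -
  have "((\<lambda>x. complex_of_real (rflat a j x)) has_vector_derivative
      complex_of_real (rflat a (j + 2) x - real j * rflat a (j + 1) x)) (at x within {a..b})"
    using rflat_has_derivative[OF assms ab, of j]
    unfolding has_real_derivative_iff_has_vector_derivative
    by (rule bounded_linear.has_vector_derivative[OF bounded_linear_of_real])
  then show ?thesis by (simp add: flat_def[abs_def])
qed

lemma mult_flat_D_space: "p \<in> B1 a b \<Longrightarrow> (\<lambda>x. p x * flat j x) \<in> D_space n a b"
proof (induction n arbitrary: p j)
  case 0
  have "continuous_on {a..b} (flat j)"
    by (rule continuous_on_vector_derivative) (rule flat_has_derivative)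
  then show ?case using B1_cont[OF ab 0] by (simp add: D_space_0[OF ab] continuous_on_mult)
next
  case (Suc n)
  let ?p' = "deriv_op a b p"
  have p: "p \<in> C_diff a b (Suc n)" for n using Suc.prems by (auto simp: B1_def)
  have p': "?p' \<in> B1 a b" using p by (auto simp: B1_def C_diff_Suc)
  show ?case
  proof (rule D_space_SucI[OF ab])
    show "((\<lambda>x. p x * flat j x) has_vector_derivative
        p x * flat (j + 2) x + ((- of_nat j * p x) * flat (j + 1) x + ?p' x * flat j x)) (at x within {a..b})"
      if x: "x \<in> {a..b}" for x
      using has_vector_derivative_mult[OF C_diff_has_derivative[OF p x] flat_has_derivative[OF x], of j]
      by (simp add: algebra_simps)
    show "p a * flat j a = 0" by (simp add: flat_def rflat_def)
    show "(\<lambda>x. p x * flat (j + 2) x + ((- of_nat j * p x) * flat (j + 1) x + ?p' x * flat j x)) \<in> D_space n a b"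
      by (intro D_space_add[OF ab] Suc.IH Suc.prems p' B1_mult[OF ab] B1_const[OF ab])
  qed
qed

lemma mult_flat_M_space: "p \<in> B1 a b \<Longrightarrow> (\<lambda>x. p x * flat j x) \<in> M_space a b"
  using mult_flat_D_space by (auto simp: M_space_eq[OF ab])

lemma polynomial_function_B1:
  fixes q :: "real \<Rightarrow> complex"
  assumes "polynomial_function q"
  shows "q \<in> B1 a b"
proof -
  have "q \<in> C_diff a b n" for n
    using assms
  proof (induction n arbitrary: q)
    case 0
    then show ?case by (simp add: continuous_on_polymonial_function)
  next
    case (Suc n)
    obtain q' where q': "polynomial_function q'" "\<And>x. (q has_vector_derivative q' x) (at x)"
      using has_vector_derivative_polynomial_function[OF Suc.prems] by blast
    show ?case
      by (rule C_diff_SucI[OF ab has_vector_derivative_at_within[OF q'(2)] Suc.IH[OF q'(1)]])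
  qed
  then show ?thesis by (simp add: B1_def)
qed

lemma linear_has_derivative:
  "((\<lambda>z. complex_of_real (z - x0)) has_vector_derivative 1) (at x within S)"
  by (auto intro!: derivative_eq_intros)

lemma linear_power_B1: "(\<lambda>z. complex_of_real (z - x0) ^ j) \<in> B1 a b"
proof (induction j)
  case 0
  then show ?case using B1_const[OF ab] by simp
next
  case (Suc j)
  have "(\<lambda>z. complex_of_real (z - x0)) \<in> C_diff a b n" for n
  proof (cases n)
    case (Suc m)
    then show ?thesis using C_diff_SucI[OF ab linear_has_derivative C_diff_const[OF ab]] by blast
  qed (auto intro: continuous_intros)
  then have "(\<lambda>z. complex_of_real (z - x0)) \<in> B1 a b" by (simp add: B1_def)
  from B1_mult[OF ab this Suc.IH] show ?case by simp
qed

lemma B1_deriv: "r \<in> B1 a b \<Longrightarrow> deriv_op a b r \<in> B1 a b"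
  unfolding B1_def by (auto simp: C_diff_Suc dest: spec[of _ "Suc _"])

text \<open>The factor \<open>(z - x0)\<^sup>j\<close> kills all terms of a differential operator of order at most \<open>j\<close> at \<open>x0\<close>
  except the one of order \<open>j\<close>.\<close>

lemma deriv_funpow_power_mult:
  assumes "r \<in> B1 a b" "x0 \<in> {a..b}" "i \<le> j"
  shows "(deriv_op a b ^^ i) (\<lambda>z. complex_of_real (z - x0) ^ j * r z) x0 = (if i = j then fact j * r x0 else 0)"
  using assms(1,3)
proof (induction i arbitrary: j r)
  case 0
  then show ?case by (cases j) auto
next
  case (Suc i)
  obtain j' where j: "j = Suc j'" using Suc.prems by (cases j) auto
  let ?l = "\<lambda>z. complex_of_real (z - x0)"
  let ?s = "\<lambda>z. of_nat (Suc j') * r z + ?l z ^ 1 * deriv_op a b r z"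
  have s: "?s \<in> B1 a b"
    by (intro B1_add[OF ab] B1_mult[OF ab] B1_const[OF ab] linear_power_B1 B1_deriv Suc.prems)
  have r1: "r \<in> C_diff a b (Suc 0)" using Suc.prems by (simp add: B1_def)
  have d: "deriv_op a b (\<lambda>z. ?l z ^ j * r z) x = ?l x ^ j' * ?s x" if x: "x \<in> {a..b}" for x
  proof (rule deriv_op_eq[OF ab _ x])
    have "((\<lambda>z. ?l z ^ j) has_vector_derivative of_nat j * ?l x ^ (j - 1) * 1) (at x within {a..b})"
    proof -
      have "((\<lambda>w. w ^ j) has_field_derivative of_nat j * ?l x ^ (j - 1)) (at (?l x) within ?l ` {a..b})"
        by (auto intro!: derivative_eq_intros)
      from field_vector_diff_chain_within[OF linear_has_derivative this]
      show ?thesis by (simp add: o_def)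
    qed
    from has_vector_derivative_mult[OF this C_diff_has_derivative[OF r1 x]]
    have "((\<lambda>z. ?l z ^ j * r z) has_vector_derivative
        ?l x ^ j * deriv_op a b r x + of_nat j * ?l x ^ (j - 1) * 1 * r x) (at x within {a..b})" .
    moreover have "?l x ^ j * deriv_op a b r x + of_nat j * ?l x ^ (j - 1) * 1 * r x = ?l x ^ j' * ?s x"
      by (simp add: j algebra_simps)
    ultimately show "((\<lambda>z. ?l z ^ j * r z) has_vector_derivative ?l x ^ j' * ?s x) (at x within {a..b})"
      by (simp only:)
  qed
  have "(deriv_op a b ^^ Suc i) (\<lambda>z. ?l z ^ j * r z) x0 = (deriv_op a b ^^ i) (\<lambda>z. ?l z ^ j' * ?s z) x0"
    unfolding deriv_op_funpow_Suc by (rule deriv_op_funpow_cong[OF d assms(2)])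
  also have "\<dots> = (if i = j' then fact j' * ?s x0 else 0)"
    using Suc.IH[OF s, of j'] Suc.prems j by simp
  also have "\<dots> = (if Suc i = j then fact j * r x0 else 0)"
    by (simp add: j algebra_simps)
  finally show ?case .
qed

text \<open>Multiplying a test function by \<open>(z - x)\<^sup>m\<^sup>+\<^sup>1\<close> removes the differential operator at \<open>x\<close>, so that a kernel
  weighted by a function without zeros in \<open>(a,x)\<close> is orthogonal to all polynomials and hence
  vanishes there. Once the Volterra part is gone, \<open>(z - x)\<^sup>m\<close> isolates the coefficient of highest order,
  and descending induction on the order removes all of them. At \<open>x = a\<close> every test function is flat;
  there the coefficients vanish by continuity.\<close>

lemma IM_decomposition_zero:
  assumes P: "\<And>i. i \<le> m \<Longrightarrow> P i \<in> B1 a b" and C: "C \<in> C_tri a b 0"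
    and zero: "\<And>\<psi> x. \<psi> \<in> M_space a b \<Longrightarrow> x \<in> {a..b} \<Longrightarrow> diff_op a b m P \<psi> x + volt_op a C \<psi> x = 0"
  shows "(\<forall>i\<le>m. \<forall>x\<in>{a..b}. P i x = 0) \<and> (\<forall>u. \<forall>x\<in>{a..b}. volt_op a C u x = 0)"
proof -
  let ?l = "\<lambda>x z. complex_of_real (z - x)"
  have flat_c: "continuous_on {a..b} (flat j)" for j
    by (rule continuous_on_vector_derivative) (rule flat_has_derivative)
  have test: "(\<lambda>z. ?l x z ^ j * (q z * flat 0 z)) \<in> M_space a b" if "q \<in> B1 a b" for x j q
    using mult_flat_M_space[OF B1_mult[OF ab linear_power_B1 that], of x j 0] by (simp add: mult.assoc)
  have jet: "(deriv_op a b ^^ i) (\<lambda>z. ?l x z ^ j * (q z * flat 0 z)) x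
     = (if i = j then fact j * (q x * flat 0 x) else 0)" if "q \<in> B1 a b" "x \<in> {a..b}" "i \<le> j" for x i j q
    using mult_flat_M_space[OF that(1), of 0] that
    by (intro deriv_funpow_power_mult) (auto simp: M_space_def)
  have C0: "C x z = 0" if x: "a < x" "x \<le> b" and z: "a < z" "z < x" for x z
  proof -
    let ?g = "\<lambda>z. C x z * (?l x z ^ Suc m * flat 0 z)"
    have "?g z = 0"
    proof (rule orthogonal_to_polynomials[of a x ?g])
      show "continuous_on {a..x} ?g"
        using x by (intro continuous_intros C_tri_0_compose[OF C] continuous_on_subset[OF flat_c]) auto
      show "integral {a..x} (\<lambda>z. ?g z * q z) = 0" if "polynomial_function q" for q
      proof -
        have q: "q \<in> B1 a b" using that by (rule polynomial_function_B1)
        let ?\<psi> = "\<lambda>z. ?l x z ^ Suc m * (q z * flat 0 z)"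
        have "diff_op a b m P ?\<psi> x = 0"
          unfolding diff_op_def using jet[OF q, of x _ "Suc m"] x by (intro sum.neutral) auto
        then have "volt_op a C ?\<psi> x = 0"
          using zero[OF test[OF q, of x "Suc m"], of x] x by simp
        then show ?thesis by (simp add: volt_op_def algebra_simps)
      qed
    qed (use x z in auto)
    then show ?thesis using z flat_nonzero[of z 0] by auto
  qed
  have V: "volt_op a C u x = 0" if "x \<in> {a..b}" for u x
  proof -
    have "integral {a..x} (\<lambda>z. C x z * u z) = integral {a..x} (\<lambda>z. 0)"
      by (rule integral_spike[of "{a, x}"]) (use that C0 in auto)
    then show ?thesis by (simp add: volt_op_def)
  qed
  have "(\<forall>i\<le>m'. P i x = 0)" if x: "a < x" "x \<le> b" and m': "m' \<le> m"
     and "\<And>\<psi>. \<psi> \<in> M_space a b \<Longrightarrow> diff_op a b m' P \<psi> x = 0" for x m'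
    using that(3,4)
  proof (induction m')
    case 0
    then have "P 0 x * flat 0 x = 0"
      using mult_flat_M_space[OF B1_const[OF ab], of 1 0] 0(2)[of "flat 0"] by (simp add: diff_op_def)
    then show ?case using flat_nonzero[OF x(1)] by simp
  next
    case (Suc m')
    let ?\<psi> = "\<lambda>z. ?l x z ^ Suc m' * (1 * flat 0 z)"
    have \<psi>: "?\<psi> \<in> M_space a b" by (rule test[OF B1_const[OF ab]])
    have "diff_op a b (Suc m') P ?\<psi> x = (\<Sum>i\<le>Suc m'. if i = Suc m' then P i x * (fact (Suc m') * (1 * flat 0 x)) else 0)"
      unfolding diff_op_def
      by (rule sum.cong[OF refl]) (use jet[OF B1_const[OF ab, of 1], of x _ "Suc m'"] x in auto)
    then have "P (Suc m') x * (fact (Suc m') * (1 * flat 0 x)) = 0"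
      using Suc.prems(2)[OF \<psi>] by simp
    then have top: "P (Suc m') x = 0" using flat_nonzero[OF x(1)] by (auto simp del: fact_Suc)
    have "diff_op a b m' P \<psi> x = 0" if "\<psi> \<in> M_space a b" for \<psi>
      using Suc.prems(2)[OF that] top by (simp add: diff_op_def)
    then show ?case using Suc.IH Suc.prems(1) top by (auto simp: le_Suc_eq)
  qed
  from this[OF _ _ order_refl] have P0: "P i x = 0" if "i \<le> m" "a < x" "x \<le> b" for i x
    using zero V that by fastforce
  have "P i x = 0" if i: "i \<le> m" and x: "x \<in> {a..b}" for i x
  proof -
    have "closure {a<..b} = {a..b}" using ab by simp
    then show ?thesis
      using continuous_constant_on_closure[of "{a<..b}" "P i" 0 x] B1_cont[OF ab P[OF i]] P0[OF i] x by auto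
  qed
  then show ?thesis using V by blast
qed

end

section \<open>The solution formula\<close>

lemma IM_funpow: "A \<in> IM a b \<Longrightarrow> A ^^ Suc i \<in> IM a b"
  by (induction i) (auto intro: IM.comp)

lemma IM_sum:
  assumes "\<And>i. 1 \<le> i \<Longrightarrow> i \<le> Suc n \<Longrightarrow> A i \<in> IM a b"
  shows "(\<lambda>\<psi> x. \<Sum>i=1..Suc n. A i \<psi> x) \<in> IM a b"
  using assms
proof (induction n)
  case 0
  then show ?case by simp
next
  case (Suc n)
  have "(\<lambda>\<psi> x. (\<Sum>i=1..Suc n. A i \<psi> x) + A (Suc (Suc n)) \<psi> x) \<in> IM a b"
    by (rule IM.add[OF Suc.IH]) (auto intro: Suc.prems)
  then show ?case by simp
qed

lemma IM_diff_op: "(\<And>i. i \<le> m \<Longrightarrow> P i \<in> B1 a b) \<Longrightarrow> diff_op a b m P \<in> IM a b"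
proof (induction m)
  case 0
  have "diff_op a b 0 P = mult_op (P 0)" by (simp add: fun_eq_iff diff_op_def mult_op_def)
  then show ?case using 0 by (simp add: IM.mult)
next
  case (Suc m)
  have eq: "diff_op a b (Suc m) P = (\<lambda>\<phi> x. diff_op a b m P \<phi> x + (mult_op (P (Suc m)) \<circ> deriv_op a b ^^ Suc m) \<phi> x)"
    by (simp add: fun_eq_iff diff_op_def mult_op_def)
  show ?case
    unfolding eq by (intro IM.add Suc.IH IM.comp IM.mult IM_funpow IM.deriv Suc.prems) auto
qed

context
  fixes a b :: real
  assumes ab: "a < b"
begin

text \<open>Two decompositions that agree on \<open>M_space\<close> agree on every continuous \<open>u\<close>, however few derivatives it
  has: a derivative that does not exist is some arbitrary value, but its coefficients on the two sides
  are the same (an index beyond the order of one of the sides counting as coefficient \<open>0\<close>).\<close>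

lemma decomposition_unique:
  assumes P: "\<And>i. i \<le> m \<Longrightarrow> P i \<in> B1 a b" and C: "C \<in> B2 a b"
    and P1: "\<And>i. i \<le> m1 \<Longrightarrow> P1 i \<in> B1 a b" and C1: "C1 \<in> B2 a b"
    and eq: "\<And>\<psi> x. \<psi> \<in> M_space a b \<Longrightarrow> x \<in> {a..b} \<Longrightarrow>
      diff_op a b m P \<psi> x + volt_op a C \<psi> x = diff_op a b m1 P1 \<psi> x + volt_op a C1 \<psi> x"
    and u: "continuous_on {a..b} u" and x: "x \<in> {a..b}"
  shows "diff_op a b m P u x + volt_op a C u x = diff_op a b m1 P1 u x + volt_op a C1 u x"
proof -
  define N where "N = max m m1"
  define Q where "Q = (\<lambda>i x. (if i \<le> m then P i else (\<lambda>_. 0)) x + (- 1) * (if i \<le> m1 then P1 i else (\<lambda>_. 0)) x)"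
  let ?E = "\<lambda>x z. C x z + - C1 x z"
  have Q: "Q i \<in> B1 a b" for i
    unfolding Q_def by (intro B1_add[OF ab] B1_mult[OF ab]) (auto simp: P P1 B1_const[OF ab])
  have dQ: "diff_op a b N Q v x = diff_op a b m P v x - diff_op a b m1 P1 v x" for v x
  proof -
    have "m \<le> N" "m1 \<le> N" by (auto simp: N_def)
    from diff_op_pad[OF this(1)] diff_op_pad[OF this(2)] show ?thesis
      by (simp add: diff_op_def Q_def algebra_simps sum_subtractf)
  qed
  have E: "?E \<in> B2 a b" by (intro B2_add[OF ab] B2_uminus[OF ab] C C1)
  have vE: "volt_op a ?E v x = volt_op a C v x - volt_op a C1 v x"
    if "continuous_on {a..b} v" "x \<in> {a..b}" for v x
  proof -
    have "volt_op a ?E v x = volt_op a C v x + volt_op a (\<lambda>x z. - C1 x z) v x"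
      by (rule volt_op_add_left[OF ab B2_cont[OF ab C] B2_cont[OF ab B2_uminus[OF ab C1]] that])
    then show ?thesis by (simp add: volt_op_def)
  qed
  have z: "(\<forall>i\<le>N. \<forall>x\<in>{a..b}. Q i x = 0) \<and> (\<forall>u. \<forall>x\<in>{a..b}. volt_op a ?E u x = 0)"
  proof (rule IM_decomposition_zero[OF ab Q B2_cont[OF ab E]])
    fix \<psi> x assume \<psi>: "\<psi> \<in> M_space a b" and x: "x \<in> {a..b}"
    have \<psi>c: "continuous_on {a..b} \<psi>" using \<psi> B1_cont[OF ab] by (auto simp: M_space_def)
    have "diff_op a b N Q \<psi> x + volt_op a ?E \<psi> x
        = (diff_op a b m P \<psi> x + volt_op a C \<psi> x) - (diff_op a b m1 P1 \<psi> x + volt_op a C1 \<psi> x)"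
      unfolding dQ vE[OF \<psi>c x] by simp
    then show "diff_op a b N Q \<psi> x + volt_op a ?E \<psi> x = 0"
      using eq[OF \<psi> x] by simp
  qed
  have "diff_op a b N Q u x = 0"
    unfolding diff_op_def by (rule sum.neutral) (use z x in auto)
  then show ?thesis using z x dQ[of u x] vE[OF u x] by simp
qed

end

theorem mainTheorem8:
  fixes a b :: real and n :: nat
    and f k H :: "real \<Rightarrow> real \<Rightarrow> complex" and h \<phi> :: "real \<Rightarrow> complex"
    and A1 A2 :: "(real \<Rightarrow> complex) \<Rightarrow> real \<Rightarrow> complex"
  assumes "a < b" and "n \<ge> 1"
    and "f \<in> B2 a b"
    and "h = (\<lambda>x. (pdx a b ^^ (n - 1)) f x x)"
    and "\<forall>x\<in>{a..b}. h x \<noteq> 0"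
    and "\<forall>i<n - 1. \<forall>x\<in>{a..b}. (pdx a b ^^ i) f x x = 0"
    and "\<phi> \<in> D_space n a b"
    and "k = (\<lambda>x y. - (pdx a b ^^ n) f x y / h x)"
    and "H = resolvent k"
    and "A1 = (\<lambda>\<psi> x. \<Sum>i=1..n.
           ((volt_op a k ^^ i) \<circ> mult_op (\<lambda>x. 1 / h x) \<circ> (deriv_op a b ^^ n)) \<psi> x)"
    and "A2 = (volt_op a k ^^ n) \<circ> mult_op (\<lambda>x. 1 / h x) \<circ> (deriv_op a b ^^ n)"
  shows "(\<exists>m P C. (\<forall>i\<le>m. P i \<in> B1 a b) \<and> C \<in> B2 a b \<and>
            IM_eq a b A1 (\<lambda>\<psi> x. diff_op a b m P \<psi> x + volt_op a C \<psi> x)) \<and>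
         (\<exists>S D. S \<in> B1 a b \<and> D \<in> B2 a b \<and>
            IM_eq a b A2 (\<lambda>\<psi> x. mult_op S \<psi> x + volt_op a D \<psi> x)) \<and>
         (\<forall>m P C S D R y.
            (\<forall>i\<le>m. P i \<in> B1 a b) \<and> C \<in> B2 a b \<and>
            IM_eq a b A1 (\<lambda>\<psi> x. diff_op a b m P \<psi> x + volt_op a C \<psi> x) \<and>
            S \<in> B1 a b \<and> D \<in> B2 a b \<and>
            IM_eq a b A2 (\<lambda>\<psi> x. mult_op S \<psi> x + volt_op a D \<psi> x) \<and>
            R = (\<lambda>x y. C x y + S y * H x y + integral {y..x} (\<lambda>z. H x z * D z y)) \<and>
            y = (\<lambda>x. 1 / h x * (deriv_op a b ^^ n) \<phi> x + diff_op a b m P \<phi> x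
                     + integral {a..x} (\<lambda>z. R x z * \<phi> z))
            \<longrightarrow> volterra_solution a b f \<phi> y \<and>
                (\<forall>u. volterra_solution a b f \<phi> u \<longrightarrow> (\<forall>x\<in>{a..b}. u x = y x)))"
proof -
  note ab = \<open>a < b\<close>
  obtain n0 where n: "n = Suc n0" using \<open>n \<ge> 1\<close> by (cases n) auto
  define p where "p = (\<lambda>x. 1 / h x)"
  let ?V = "volt_op a k" and ?F = "(pdx a b ^^ n) f"
  have F: "?F \<in> B2 a b" and hB: "h \<in> B1 a b"
    unfolding assms(4) using assms(3) by (auto intro: B2_diagonal[OF ab] B2_pdx_funpow[OF ab])
  have h0: "h x \<noteq> 0" if "x \<in> {a..b}" for x using assms(5) that by auto
  have p: "p \<in> B1 a b"
    using hB h0 C_diff_inverse[OF ab] by (auto simp: B1_def p_def)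
  have "(\<lambda>x y. p x * - ?F x y) \<in> B2 a b"
    by (intro B2_mult_fst[OF ab p] B2_uminus[OF ab F])
  then have k: "k \<in> B2 a b" by (simp add: assms(8) p_def)
  then have kc: "k \<in> C_tri a b 0" by (rule B2_cont[OF ab])
  note Hc = resolvent_C_tri_0[OF kc]

  have A1_eq: "A1 \<psi> x = (\<Sum>i=1..n. (?V ^^ i) (\<lambda>x. p x * (deriv_op a b ^^ n) \<psi> x) x)"
    and A2_eq: "A2 \<psi> x = (?V ^^ n) (\<lambda>x. p x * (deriv_op a b ^^ n) \<psi> x) x" for \<psi> x
    by (simp_all add: assms(10,11) p_def mult_op_def[abs_def])
  have term_IM: "(?V ^^ Suc i) \<circ> mult_op p \<circ> (deriv_op a b ^^ Suc j) \<in> IM a b" for i j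
    by (intro IM.comp IM_funpow IM.volt IM.mult IM.deriv k p)
  have A2_IM: "A2 \<in> IM a b"
    using term_IM unfolding assms(11) n p_def .
  have A1_IM: "A1 \<in> IM a b"
    unfolding assms(10) n
  proof (rule IM_sum)
    fix i :: nat assume "1 \<le> i"
    then obtain i0 where "i = Suc i0" by (cases i) auto
    then show "(?V ^^ i) \<circ> mult_op (\<lambda>x. 1 / h x) \<circ> (deriv_op a b ^^ Suc n0) \<in> IM a b"
      using term_IM[of i0 n0] by (simp only: p_def)
  qed
  have M_D: "\<psi> \<in> D_space n a b" if "\<psi> \<in> M_space a b" for \<psi>
    using that by (auto simp: M_space_eq[OF ab])

  obtain P0 C0 where P0: "\<And>i. P0 i \<in> B1 a b" and C0: "C0 \<in> B2 a b"
    and PC0: "\<And>\<psi> x. \<psi> \<in> D_space n a b \<Longrightarrow> x \<in> {a..b} \<Longrightarrow> A1 \<psi> x = diff_op a b n P0 \<psi> x + volt_op a C0 \<psi> x"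
    unfolding A1_eq using sum_volt_op_funpow_deriv_funpow[OF ab k p order_refl, of n] by blast
  obtain S0 D0 where S0: "S0 \<in> B1 a b" and D0: "D0 \<in> B2 a b"
    and SD0: "\<And>\<psi> x. \<psi> \<in> D_space n a b \<Longrightarrow> x \<in> {a..b} \<Longrightarrow> A2 \<psi> x = S0 x * \<psi> x + volt_op a D0 \<psi> x"
    unfolding A2_eq using volt_op_funpow_deriv_funpow[OF ab k p, of n] by blast

  have ex1: "\<exists>m P C. (\<forall>i\<le>m. P i \<in> B1 a b) \<and> C \<in> B2 a b \<and>
      IM_eq a b A1 (\<lambda>\<psi> x. diff_op a b m P \<psi> x + volt_op a C \<psi> x)"
  proof (intro exI conjI)
    show "\<forall>i\<le>n. P0 i \<in> B1 a b" using P0 by blast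
    show "C0 \<in> B2 a b" by (rule C0)
    show "IM_eq a b A1 (\<lambda>\<psi> x. diff_op a b n P0 \<psi> x + volt_op a C0 \<psi> x)"
      unfolding IM_eq_def using A1_IM PC0 M_D by (auto intro!: IM.add IM_diff_op IM.volt P0 C0)
  qed
  have ex2: "\<exists>S D. S \<in> B1 a b \<and> D \<in> B2 a b \<and>
      IM_eq a b A2 (\<lambda>\<psi> x. mult_op S \<psi> x + volt_op a D \<psi> x)"
  proof (intro exI conjI)
    show "S0 \<in> B1 a b" "D0 \<in> B2 a b" by (rule S0 D0)+
    show "IM_eq a b A2 (\<lambda>\<psi> x. mult_op S0 \<psi> x + volt_op a D0 \<psi> x)"
      unfolding IM_eq_def
    proof (intro conjI ballI)
      show "(\<lambda>\<psi> x. mult_op S0 \<psi> x + volt_op a D0 \<psi> x) \<in> IM a b"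
        by (intro IM.add IM.mult IM.volt S0 D0)
    qed (use A2_IM SD0 M_D in \<open>auto simp: mult_op_def\<close>)
  qed

  define g where "g = (\<lambda>x. p x * (deriv_op a b ^^ n) \<phi> x)"
  have \<phi>c: "continuous_on {a..b} \<phi>" by (rule D_space_cont[OF ab assms(7)])
  have "(deriv_op a b ^^ n) \<phi> \<in> D_space 0 a b"
    by (rule D_space_funpow[OF ab]) (use assms(7) in simp)
  then have gc: "continuous_on {a..b} g"
    unfolding g_def using B1_cont[OF ab p] by (auto simp: D_space_0[OF ab] intro: continuous_on_mult)
  note Vc = volt_op_funpow_continuous[OF ab kc gc]

  have second_kind: "volterra_solution a b f \<phi> u \<longleftrightarrow> (\<forall>x\<in>{a..b}. u x = g x + ?V u x)"
    if u: "continuous_on {a..b} u" for u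
  proof -
    have kF: "?V u x = - (p x * volt_op a ?F u x)" for x
    proof -
      have "?V u x = integral {a..x} (\<lambda>z. - p x * (?F x z * u z))"
        unfolding volt_op_def assms(8) p_def by (rule integral_cong) simp
      then show ?thesis by (simp add: volt_op_def)
    qed
    have "volterra_solution a b f \<phi> u \<longleftrightarrow> (\<forall>x\<in>{a..b}. volt_op a f u x = \<phi> x)"
      using u by (simp add: volterra_solution_def volt_op_def)
    also have "\<dots> \<longleftrightarrow> (\<forall>x\<in>{a..b}. (pdx a b ^^ n0) f x x * u x + volt_op a ?F u x = (deriv_op a b ^^ n) \<phi> x)"
      using assms(6,7) unfolding n by (intro first_kind_iff[OF ab assms(3) _ _ u]) auto
    also have "\<dots> \<longleftrightarrow> (\<forall>x\<in>{a..b}. u x = g x + ?V u x)"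
    proof (rule ball_cong[OF refl])
      fix x assume x: "x \<in> {a..b}"
      have "(pdx a b ^^ n0) f x x = h x" by (simp add: assms(4) n)
      then show "((pdx a b ^^ n0) f x x * u x + volt_op a ?F u x = (deriv_op a b ^^ n) \<phi> x) \<longleftrightarrow> u x = g x + ?V u x"
        unfolding kF g_def p_def using h0[OF x] by (auto simp: field_simps)
    qed
    finally show ?thesis .
  qed

  have formula: "volterra_solution a b f \<phi> y \<and> (\<forall>u. volterra_solution a b f \<phi> u \<longrightarrow> (\<forall>x\<in>{a..b}. u x = y x))"
    if P: "\<forall>i\<le>m. P i \<in> B1 a b" and C: "C \<in> B2 a b"
      and PC: "IM_eq a b A1 (\<lambda>\<psi> x. diff_op a b m P \<psi> x + volt_op a C \<psi> x)"
      and S: "S \<in> B1 a b" and D: "D \<in> B2 a b"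
      and SD: "IM_eq a b A2 (\<lambda>\<psi> x. mult_op S \<psi> x + volt_op a D \<psi> x)"
      and R: "R = (\<lambda>x y. C x y + S y * H x y + integral {y..x} (\<lambda>z. H x z * D z y))"
      and y: "y = (\<lambda>x. 1 / h x * (deriv_op a b ^^ n) \<phi> x + diff_op a b m P \<phi> x
                     + integral {a..x} (\<lambda>z. R x z * \<phi> z))"
    for m P C S D R y
  proof -
    have A1\<phi>: "diff_op a b m P \<phi> x + volt_op a C \<phi> x = (\<Sum>i=1..n. (?V ^^ i) g x)" if x: "x \<in> {a..b}" for x
    proof -
      have "diff_op a b m P \<phi> x + volt_op a C \<phi> x = diff_op a b n P0 \<phi> x + volt_op a C0 \<phi> x"
        using PC PC0 M_D unfolding IM_eq_def
        by (intro decomposition_unique[OF ab _ C _ C0 _ \<phi>c x]) (auto simp: P P0)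
      also have "\<dots> = A1 \<phi> x" using PC0[OF assms(7) x] by simp
      finally show ?thesis by (simp add: A1_eq g_def)
    qed
    have A2\<phi>: "S x * \<phi> x + volt_op a D \<phi> x = (?V ^^ n) g x" if x: "x \<in> {a..b}" for x
    proof -
      have "diff_op a b 0 (\<lambda>_. S) \<phi> x + volt_op a D \<phi> x = diff_op a b 0 (\<lambda>_. S0) \<phi> x + volt_op a D0 \<phi> x"
        using SD SD0 M_D unfolding IM_eq_def
        by (intro decomposition_unique[OF ab _ D _ D0 _ \<phi>c x]) (auto simp: S S0 diff_op_def mult_op_def)
      also have "\<dots> = A2 \<phi> x" using SD0[OF assms(7) x] by (simp add: diff_op_def)
      finally show ?thesis by (simp add: A2_eq g_def diff_op_def)
    qed
    let ?HS = "\<lambda>x z. H x z * S z" and ?HD = "kcomp H D"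
    have HS: "?HS \<in> C_tri a b 0"
      using Hc C_tri_0_mult[OF _ C_tri_0_snd[OF B1_cont[OF ab S]]] assms(9) by blast
    have HD: "?HD \<in> C_tri a b 0"
      using kcomp_C_tri_0[OF Hc B2_cont[OF ab D]] assms(9) by simp
    have R\<phi>: "volt_op a R \<phi> x = volt_op a C \<phi> x + volt_op a H ((?V ^^ n) g) x" if x: "x \<in> {a..b}" for x
    proof -
      have "volt_op a R \<phi> x = volt_op a (\<lambda>x z. C x z + (?HS x z + ?HD x z)) \<phi> x"
        by (rule volt_op_cong) (auto simp: R kcomp_def)
      also have "\<dots> = volt_op a C \<phi> x + (volt_op a ?HS \<phi> x + volt_op a ?HD \<phi> x)"
        using volt_op_add_left[OF ab B2_cont[OF ab C] C_tri_0_add[OF HS HD] \<phi>c x]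
          volt_op_add_left[OF ab HS HD \<phi>c x] by simp
      also have "volt_op a ?HS \<phi> x + volt_op a ?HD \<phi> x = volt_op a H (\<lambda>x. S x * \<phi> x) x + volt_op a H (volt_op a D \<phi>) x"
        using volt_op_volt_op[OF ab Hc B2_cont[OF ab D] \<phi>c x] assms(9) by (simp add: volt_op_mult_right)
      also have "\<dots> = volt_op a H (\<lambda>x. S x * \<phi> x + volt_op a D \<phi> x) x"
        unfolding assms(9)
        by (intro volt_op_add_right[OF ab Hc, symmetric] continuous_on_mult B1_cont[OF ab S] \<phi>c
              volt_op_continuous[OF ab B2_cont[OF ab D] \<phi>c] x)
      also have "\<dots> = volt_op a H ((?V ^^ n) g) x"
        using x by (intro volt_op_cong A2\<phi>) auto
      finally show ?thesis .
    qed
    define Y where "Y = (\<lambda>x. g x + (\<Sum>i=1..n. (?V ^^ i) g x) + volt_op a (resolvent k) ((?V ^^ n) g) x)"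
    have yY: "y x = Y x" if x: "x \<in> {a..b}" for x
    proof -
      have "y x = g x + diff_op a b m P \<phi> x + volt_op a R \<phi> x"
        by (simp add: y g_def p_def volt_op_def)
      also have "\<dots> = g x + (diff_op a b m P \<phi> x + volt_op a C \<phi> x) + volt_op a H ((?V ^^ n) g) x"
        by (simp add: R\<phi>[OF x])
      also have "\<dots> = Y x" by (simp only: A1\<phi>[OF x] Y_def assms(9))
      finally show ?thesis .
    qed
    have Yc: "continuous_on {a..b} Y"
      unfolding Y_def by (intro continuous_on_add continuous_on_sum gc Vc volt_op_continuous[OF ab Hc Vc])
    then have yc: "continuous_on {a..b} y"
      by (rule continuous_on_eq) (simp add: yY)
    have ysol: "y x = g x + ?V y x" if x: "x \<in> {a..b}" for x
    proof -
      have "y x = g x + ?V Y x"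
        using second_kind_solution[OF ab kc gc x, of n] yY[OF x] by (simp add: Y_def)
      also have "?V Y x = ?V y x"
        using x yY by (intro volt_op_cong) auto
      finally show ?thesis .
    qed
    have "u x = y x" if u: "volterra_solution a b f \<phi> u" and x: "x \<in> {a..b}" for u x
    proof -
      have uc: "continuous_on {a..b} u" using u by (simp add: volterra_solution_def)
      have usol: "u x = g x + ?V u x" if "x \<in> {a..b}" for x
        using second_kind[OF uc] u that by blast
      have "u x + (- 1) * y x = 0"
      proof (rule volt_op_fixpoint_zero[OF ab kc _ _ x])
        show "continuous_on {a..b} (\<lambda>x. u x + (- 1) * y x)"
          using uc yc by (intro continuous_intros)
        fix x assume x: "x \<in> {a..b}"
        have "?V (\<lambda>x. u x + (- 1) * y x) x = ?V u x + ?V (\<lambda>x. (- 1) * y x) x"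
          using uc yc by (intro volt_op_add_right[OF ab kc _ _ x] continuous_intros)
        also have "?V (\<lambda>x. (- 1) * y x) x = - ?V y x" by (simp add: volt_op_def)
        finally show "u x + (- 1) * y x = ?V (\<lambda>x. u x + (- 1) * y x) x"
          using usol[OF x] ysol[OF x] by simp
      qed
      then show ?thesis by simp
    qed
    then show ?thesis using second_kind[OF yc] ysol by blast
  qed
  show ?thesis
    by (intro conjI ex1 ex2 allI impI; (elim conjE)?; use formula in blast)
qed

end
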